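(* Let $G$ be a simple connected plane graph. Then $G$ is special if and only if $G$ is cubic (every vertex has degree $3$), or a sphere triangulation (every face has degree $3$), or a wheel.
   Context: The degree of a face of a plane graph is the number of edges incident to it. A connected plane graph $G$ is special if (1) all vertices and all faces of $G$ have degree $\ge 3$, and (2) whenever a vertex $x$ is incident with a face $F$, either $\deg(x)=3$ or $\deg(F)=3$. A wheel is the graph consisting of a cycle of $n\ge 3$ vertices together with one additional central vertex adjacent to all vertices of the cycle, embedded in the plane in the standard way.
   Formalization: A sphere triangulation must also have more than 3 edges: the triangle K_3 has both faces of degree 3 but vertices of degree 2, so it is not special. The standard embedding of a wheel is taken up to the choice of the outer face, and the graph is nonempty. *)

theory Defs
  imports "HOL-Analysis.Analysis"
begin

text \<open>
  The plane is the type \<^typ>\<open>complex\<close>. A plane graph is given by its finite set \<open>V\<close> of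
  vertices (points) and its finite set \<open>E\<close> of edges; an edge is the point set of an arc,
  including its two end points. As \<^const>\<open>arc\<close> is injective, there are no loops; parallel
  edges are only excluded by \<open>simple_edges\<close> below.
\<close>

definition plane_graph :: "complex set \<Rightarrow> complex set set \<Rightarrow> bool" where
  "plane_graph V E \<longleftrightarrow>
     finite V \<and> V \<noteq> {} \<and> finite E \<and>
     (\<forall>e\<in>E. \<exists>g. arc g \<and> path_image g = e \<and> e \<inter> V = {pathstart g, pathfinish g}) \<and>
     (\<forall>e\<in>E. \<forall>e'\<in>E. e \<noteq> e' \<longrightarrow> e \<inter> e' \<subseteq> V)"

text \<open>An edge meets the vertex set exactly in its two ends.\<close>

definition ends :: "complex set \<Rightarrow> complex set \<Rightarrow> complex set" where
  "ends V e = e \<inter> V"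

definition simple_edges :: "complex set \<Rightarrow> complex set set \<Rightarrow> bool" where
  "simple_edges V E \<longleftrightarrow> inj_on (ends V) E"

definition adjacent :: "complex set \<Rightarrow> complex set set \<Rightarrow> complex \<Rightarrow> complex \<Rightarrow> bool" where
  "adjacent V E u v \<longleftrightarrow> (\<exists>e\<in>E. ends V e = {u, v})"

definition connected_graph :: "complex set \<Rightarrow> complex set set \<Rightarrow> bool" where
  "connected_graph V E \<longleftrightarrow> (\<forall>u\<in>V. \<forall>v\<in>V. (adjacent V E)\<^sup>*\<^sup>* u v)"

definition faces :: "complex set \<Rightarrow> complex set set \<Rightarrow> complex set set" where
  "faces V E = components (- (V \<union> \<Union>E))"

definition vertex_degree :: "complex set set \<Rightarrow> complex \<Rightarrow> nat" where
  "vertex_degree E v = card {e \<in> E. v \<in> e}"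

definition incident_edges :: "complex set set \<Rightarrow> complex set \<Rightarrow> complex set set" where
  "incident_edges E F = {e \<in> E. e \<subseteq> frontier F}"

text \<open>A bridge is incident with a single face and is counted once in its degree.\<close>

definition face_degree :: "complex set set \<Rightarrow> complex set \<Rightarrow> nat" where
  "face_degree E F = card (incident_edges E F)"

definition special :: "complex set \<Rightarrow> complex set set \<Rightarrow> bool" where
  "special V E \<longleftrightarrow>
     (\<forall>v\<in>V. vertex_degree E v \<ge> 3) \<and>
     (\<forall>F\<in>faces V E. face_degree E F \<ge> 3) \<and>
     (\<forall>v\<in>V. \<forall>F\<in>faces V E. v \<in> frontier F \<longrightarrow> vertex_degree E v = 3 \<or> face_degree E F = 3)"

definition cubic :: "complex set \<Rightarrow> complex set set \<Rightarrow> bool" where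
  "cubic V E \<longleftrightarrow> (\<forall>v\<in>V. vertex_degree E v = 3)"

text \<open>
  The bound on the number of edges only rules out the connected simple plane graphs with exactly
  three edges (the triangle, the path and the star): all their faces have degree 3, but they do
  not triangulate the sphere, a triangulation being a simplicial complex, which has at least
  four vertices.
\<close>

definition sphere_triangulation :: "complex set \<Rightarrow> complex set set \<Rightarrow> bool" where
  "sphere_triangulation V E \<longleftrightarrow> (\<forall>F\<in>faces V E. face_degree E F = 3) \<and> card E > 3"

text \<open>
  Hub \<open>x\<close>, rim \<open>y 0, \<dots>, y (n - 1)\<close>. The standard embedding is the one in which the
  faces are bounded by the rim and by the \<open>n\<close> triangles formed by the hub and a rim edge. Any
  of these may be the unbounded face, that is, embeddings are regarded up to homeomorphism of
  the sphere.
\<close>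

definition wheel :: "complex set \<Rightarrow> complex set set \<Rightarrow> bool" where
  "wheel V E \<longleftrightarrow>
     (\<exists>n\<ge>3. \<exists>x. \<exists>y :: nat \<Rightarrow> complex.
        inj_on y {..<n} \<and> x \<notin> y ` {..<n} \<and> V = insert x (y ` {..<n}) \<and>
        (let rim = (\<lambda>i. {y i, y (Suc i mod n)});
             spoke = (\<lambda>i. {x, y i})
         in ends V ` E = rim ` {..<n} \<union> spoke ` {..<n} \<and>
            (\<lambda>F. ends V ` incident_edges E F) ` faces V E =
              insert (rim ` {..<n}) ((\<lambda>i. {rim i, spoke i, spoke (Suc i mod n)}) ` {..<n})))"

end

theory Submission
  imports Defs
begin

text \<open>
  Call a vertex good if all its faces are triangles. In a special graph a vertex that is not good
  has degree 3, so if no vertex is good, the graph is cubic, and if all are, it is a triangulation.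
  Otherwise connectedness gives a good vertex \<open>x\<close> with a neighbour that is not good. The faces at
  \<open>x\<close> arrange its neighbours in a cycle. A neighbour \<open>u\<close> that is not good has degree 3, and its only
  face away from \<open>x\<close> is not a triangle; this face also contains the next neighbour in the cycle,
  which is thus not good either. So all neighbours of \<open>x\<close> have degree 3 and the graph is a wheel.

  The topological input comes from Janiszewski's theorem and the Jordan curve theorem: a face
  boundary is a union of edges, an edge lies on at most two faces and, if it is on a closed curve,
  on exactly two, and a face whose boundary is a forest is the only face.
\<close>

section \<open>Edges on the frontier of a face\<close>

text \<open>The cyclic order of the edges around a vertex is never constructed topologically. Two
  facts replace it. A spoke on a triangular face lies on exactly two faces, so a walk around
  \<open>x\<close> can always cross it into the other face and never branches. And the faces at
  \<open>x\<close> link all edges at \<open>x\<close>, so a walk that has closed up has missed no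
  spoke. Cycles in face boundaries are not traced either: a non-empty set of boundary edges with
  minimum degree two does the same work. Among at most three edges it is a triangle, and inside the
  rim it is the whole rim. Graphs with at most three edges need separate care: a path or a star has
  a face of degree 3 that is not bounded by a triangle, and in the triangle graph two different
  faces have the same boundary.\<close>

lemma connected_subset_of_frontier_disjoint:
  assumes "connected S" "S \<inter> F \<noteq> {}" "S \<inter> frontier F = {}"
  shows "S \<subseteq> F"
  using connected_Int_frontier[of S F] assms by blast

text \<open>An arc is homeomorphic to a real interval, so invariance of dimension forbids an open
  piece of the plane inside it. Hence every ball around an inner point of an edge contains points
  off that edge.\<close>

lemma interior_arc_image_empty:
  fixes g :: "real \<Rightarrow> complex"
  assumes "arc g"
  shows "interior (path_image g) = {}"
proof (rule ccontr)
  assume ne: "interior (path_image g) \<noteq> {}"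
  obtain h where h: "homeomorphism {0..1} (path_image g) g h"
    using homeomorphism_arc[OF assms] by blast
  have "continuous_on (interior (path_image g)) h"
    using h unfolding homeomorphism_def by (meson continuous_on_subset interior_subset)
  moreover have "inj_on h (interior (path_image g))"
    using h unfolding homeomorphism_def
    by (metis inj_on_inverseI inj_on_subset interior_subset)
  ultimately have "DIM(complex) \<le> DIM(real)"
    using invariance_of_dimension ne open_interior by blast
  then show False by simp
qed

lemma inj_on_unit_notin_image:
  fixes g :: "real \<Rightarrow> 'a"
  assumes "inj_on g {0..1}" "r \<in> {0..1}" "0 \<le> a" "b \<le> 1" "r \<notin> {a..b}"
  shows "g r \<notin> g ` {a..b}"
  using inj_on_image_mem_iff[of g "{0..1}" r "{a..b}"] assms by auto

locale plane =
  fixes V :: "complex set" and E :: "complex set set"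
  assumes plane: "plane_graph V E"
begin

definition drawing :: "complex set" where
  "drawing = V \<union> \<Union>E"

text \<open>\<open>V\<close> is kept, so exactly the inner points of an edge \<open>e\<close> are
  removed from the drawing, and "inner point of \<open>e\<close>" can be written as membership in
  \<open>e\<close> but not in \<open>rest e\<close>.\<close>

definition rest :: "complex set \<Rightarrow> complex set" where
  "rest e = V \<union> \<Union>(E - {e})"

lemma finite_V: "finite V" and finite_E: "finite E" and V_ne: "V \<noteq> {}"
  using plane unfolding plane_graph_def by auto

lemma edge_arc:
  assumes "e \<in> E"
  obtains g where "arc g" "path_image g = e" "e \<inter> rest e = {g 0, g 1}" "e \<inter> V = {g 0, g 1}"
proof -
  have "\<exists>g. arc g \<and> path_image g = e \<and> e \<inter> V = {g 0, g 1}"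
    using plane assms unfolding plane_graph_def pathstart_def pathfinish_def by simp
  then obtain g where g: "arc g" "path_image g = e" "e \<inter> V = {g 0, g 1}"
    by (elim exE conjE)
  have "e \<inter> e' \<subseteq> V" if "e' \<in> E" "e' \<noteq> e" for e'
    using plane assms that unfolding plane_graph_def by blast
  then have "e \<inter> rest e = e \<inter> V"
    unfolding rest_def by blast
  then show thesis using that g by auto
qed

lemma edge_Int: "e \<in> E \<Longrightarrow> e' \<in> E \<Longrightarrow> e \<noteq> e' \<Longrightarrow> e \<inter> e' \<subseteq> V"
  using plane unfolding plane_graph_def by blast

lemma compact_edge: "e \<in> E \<Longrightarrow> compact e"
  using compact_arc_image by (auto elim: edge_arc)

lemma connected_edge: "e \<in> E \<Longrightarrow> connected e"
  using connected_arc_image by (auto elim: edge_arc)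

lemma connected_Compl_edge: "e \<in> E \<Longrightarrow> connected (- e)"
  by (erule edge_arc) (auto intro!: connected_arc_complement)

lemma compact_rest: "compact (rest e)"
  unfolding rest_def
  by (intro compact_Un[OF finite_imp_compact[OF finite_V]] compact_Union) (auto simp: finite_E compact_edge)

lemma compact_drawing: "compact drawing"
  unfolding drawing_def
  by (intro compact_Un[OF finite_imp_compact[OF finite_V]] compact_Union) (auto simp: finite_E compact_edge)

lemma closed_rest: "closed (rest e)" and closed_drawing: "closed drawing"
  using compact_rest compact_drawing compact_imp_closed by auto

lemma drawing_split: "e \<in> E \<Longrightarrow> drawing = rest e \<union> e"
  unfolding drawing_def rest_def by auto

lemma faces_eq: "faces V E = components (- drawing)"
  unfolding faces_def drawing_def ..

lemma face_open: "F \<in> faces V E \<Longrightarrow> open F"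
  unfolding faces_eq using open_components closed_drawing by blast

lemma face_connected: "F \<in> faces V E \<Longrightarrow> connected F"
  unfolding faces_eq by (rule in_components_connected)

lemma face_nonempty: "F \<in> faces V E \<Longrightarrow> F \<noteq> {}"
  unfolding faces_eq by (rule in_components_nonempty)

lemma face_disjoint: "F \<in> faces V E \<Longrightarrow> F \<inter> drawing = {}"
  unfolding faces_eq using in_components_subset by blast

lemma face_frontier: "F \<in> faces V E \<Longrightarrow> frontier F \<subseteq> drawing"
  unfolding faces_eq using frontier_of_components_closed_complement closed_drawing by blast

lemma faces_disjoint: "F \<in> faces V E \<Longrightarrow> F' \<in> faces V E \<Longrightarrow> F \<noteq> F' \<Longrightarrow> F \<inter> F' = {}"
  unfolding faces_eq using components_nonoverlap by blast

lemma obtain_face: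
  assumes "z \<notin> drawing"
  obtains F where "F \<in> faces V E" "z \<in> F"
proof -
  have "z \<in> \<Union>(components (- drawing))"
    using assms by (simp add: Union_components[symmetric])
  then show thesis using that unfolding faces_eq by blast
qed

lemma edge_subset_drawing: "e \<in> E \<Longrightarrow> e \<subseteq> drawing"
  unfolding drawing_def by auto

lemma edge_interior_point:
  assumes "e \<in> E"
  obtains p where "p \<in> e" "p \<notin> rest e"
proof -
  obtain g where g: "arc g" "path_image g = e" "e \<inter> rest e = {g 0, g 1}" "e \<inter> V = {g 0, g 1}"
    by (rule edge_arc[OF assms])
  have "g (1/2) \<in> e" using g unfolding path_image_def by auto
  moreover have "g (1/2) \<noteq> g 0" "g (1/2) \<noteq> g 1"
    using arcD[OF g(1), of "1/2" 0] arcD[OF g(1), of "1/2" 1] by auto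
  ultimately show thesis using that[of "g (1/2)"] g(3) by auto
qed

text \<open>If a point of the edge were away from \<open>F\<close>, one could cut out a short piece of the edge around
  it; the two remaining arcs each meet the rest of the drawing in one point, so by Janiszewski's
  theorem they do not separate \<open>F\<close> from the gap.\<close>

lemma edge_in_frontier:
  assumes F: "F \<in> faces V E" and e: "e \<in> E" and q: "q \<in> frontier F" "q \<in> e" "q \<notin> rest e"
  shows "e \<subseteq> frontier F"
proof -
  obtain g where g: "arc g" "path_image g = e" "e \<inter> rest e = {g 0, g 1}" "e \<inter> V = {g 0, g 1}"
    by (rule edge_arc[OF e])
  have inj: "inj_on g {0..1}" and cont: "continuous_on {0..1} g"
    using g(1) unfolding arc_def path_def by auto
  have e_img: "e = g ` {0..1}" using g(2) unfolding path_image_def by simp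
  have notrest: "g t \<notin> rest e" if "0 < t" "t < 1" for t
  proof
    assume "g t \<in> rest e"
    moreover have "g t \<in> e" using that e_img by auto
    ultimately have "g t = g 0 \<or> g t = g 1" using g(3) by blast
    then show False using inj_onD[OF inj, of t 0] inj_onD[OF inj, of t 1] that by auto
  qed
  have main: "g t \<in> closure F" if t: "0 < t" "t < 1" for t
  proof (rule ccontr)
    assume "g t \<notin> closure F"
    then have "open (- closure F)" "g t \<in> - closure F" by auto
    then obtain \<epsilon> where \<epsilon>: "\<epsilon> > 0" "ball (g t) \<epsilon> \<subseteq> - closure F"
      using open_contains_ball by blast
    have "continuous (at t within {0..1}) g" using cont t by (simp add: continuous_on_eq_continuous_within)
    then obtain \<delta> where \<delta>: "\<delta> > 0" "\<And>s. s \<in> {0..1} \<Longrightarrow> dist s t < \<delta> \<Longrightarrow> dist (g s) (g t) < \<epsilon>"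
      unfolding continuous_within_eps_delta using \<epsilon>(1) by blast
    \<comment> \<open>The removed gap lies between \<open>t - m\<close> and \<open>t + m\<close>:
      \<open>m < \<delta>\<close> keeps it in the ball that avoids \<open>closure F\<close>, and the
      bounds by \<open>t\<close> and \<open>1 - t\<close> leave a proper arc on either side.\<close>
    define m where "m = min (\<delta>/2) (min (t/2) ((1-t)/2))"
    have m: "m > 0" "m < \<delta>" "m < t" "m < 1 - t"
      using \<delta>(1) t unfolding m_def by (auto simp: min_def)
    define A1 A2 where "A1 = g ` {0..t-m}" and "A2 = g ` {t+m..1}"
    have arcs: "A1 = path_image (subpath 0 (t-m) g)" "A2 = path_image (subpath (t+m) 1 g)"
      unfolding A1_def A2_def path_image_subpath using m t by auto
    have arc12: "arc (subpath 0 (t-m) g)" "arc (subpath (t+m) 1 g)"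
      using m t by (auto intro!: arc_subpath_arc[OF g(1)])
    have comp: "compact A1" "compact A2" "connected (- A1)" "connected (- A2)"
      unfolding arcs using arc12 by (auto simp: compact_arc_image intro!: connected_arc_complement)
    obtain f where f: "f \<in> F" using face_nonempty[OF F] by auto
    have f_nd: "f \<notin> drawing" using f face_disjoint[OF F] by auto
    have sub12: "A1 \<subseteq> e" "A2 \<subseteq> e" unfolding A1_def A2_def e_img using m t by auto
    have p_notin: "g t \<notin> A1" "g t \<notin> A2"
      unfolding A1_def A2_def by (rule inj_on_unit_notin_image[OF inj]; use m t in simp)+
    have conn_open: "connected (g ` {0<..<1})"
      by (rule connected_continuous_image[OF continuous_on_subset[OF cont]]) auto
    have q_open: "q \<in> g ` {0<..<1}"
    proof -
      obtain s where s: "s \<in> {0..1}" "q = g s" using q(2) e_img by auto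
      then have "s \<noteq> 0" "s \<noteq> 1" using q(2,3) g(3) by auto
      then show ?thesis using s by auto
    qed
    \<comment> \<open>Leaving \<open>F\<close> through \<open>q\<close> and following the open edge
      reaches \<open>g t\<close> without meeting \<open>rest e\<close>.\<close>
    have "connected (F \<union> {q})"
      by (rule connected_intermediate_closure[OF face_connected[OF F]])
        (use q(1) closure_subset[of F] in \<open>auto simp: frontier_def\<close>)
    then have "connected ((F \<union> {q}) \<union> g ` {0<..<1})"
      by (rule connected_Un[OF _ conn_open]) (use q_open in auto)
    moreover have "(F \<union> {q}) \<union> g ` {0<..<1} \<subseteq> - rest e"
      using face_disjoint[OF F] drawing_split[OF e] q notrest by auto
    ultimately have "connected_component (- rest e) f (g t)"
      unfolding connected_component_def using f t by fastforce
    moreover have "connected_component (- A1) f (g t)" "connected_component (- A2) f (g t)"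
      unfolding connected_component_def using comp p_notin sub12 f_nd drawing_split[OF e] by blast+
    moreover have "A1 \<inter> rest e = {g 0}"
    proof -
      have "g 0 \<in> A1" unfolding A1_def using m by auto
      moreover have "g 1 \<notin> A1" unfolding A1_def
        by (rule inj_on_unit_notin_image[OF inj]) (use m t in auto)
      moreover have "A1 \<inter> rest e \<subseteq> {g 0, g 1}" "g 0 \<in> rest e" using sub12 g(3) by blast+
      ultimately show ?thesis by blast
    qed
    moreover have "A2 \<inter> (A1 \<union> rest e) = {g 1}"
    proof -
      have "g 1 \<in> A2" unfolding A2_def using m by auto
      moreover have "g 0 \<notin> A2" unfolding A2_def
        by (rule inj_on_unit_notin_image[OF inj]) (use m t in auto)
      moreover have "A1 \<inter> A2 = {}" unfolding A1_def A2_def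
        by (subst inj_on_image_Int[OF inj, symmetric]) (use m t in auto)
      moreover have "A2 \<inter> rest e \<subseteq> {g 0, g 1}" "g 1 \<in> rest e" using sub12 g(3) by blast+
      ultimately show ?thesis by blast
    qed
    \<comment> \<open>Janiszewski is applied twice: \<open>A1\<close> is glued to
      \<open>rest e\<close> along \<open>g 0\<close>, then \<open>A2\<close> to their union along
      \<open>g 1\<close>.\<close>
    ultimately have "connected_component (- (A2 \<union> (A1 \<union> rest e))) f (g t)"
      using comp closed_rest
      by (intro Janiszewski) (auto simp: compact_imp_closed closed_Un)
    then obtain C where C: "connected C" "C \<subseteq> - (A2 \<union> (A1 \<union> rest e))" "f \<in> C" "g t \<in> C"
      unfolding connected_component_def by blast
    \<comment> \<open>A frontier point on \<open>C\<close> would lie in the gap, which is away from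
      \<open>closure F\<close>.\<close>
    have "C \<inter> frontier F = {}"
    proof (rule ccontr)
      assume "C \<inter> frontier F \<noteq> {}"
      then obtain z where z: "z \<in> C" "z \<in> frontier F" by auto
      then have "z \<in> e" using face_frontier[OF F] drawing_split[OF e] C(2) by auto
      then obtain s where s: "s \<in> {0..1}" "z = g s" using e_img by auto
      have "\<not> s \<le> t - m" "\<not> t + m \<le> s"
        using s z C(2) unfolding A1_def A2_def by auto
      then have "dist (g s) (g t) < \<epsilon>" using \<delta>(2) s(1) m by (auto simp: dist_real_def)
      then have "z \<in> ball (g t) \<epsilon>" using s by (simp add: dist_commute)
      then show False using \<epsilon>(2) z(2) by (auto simp: frontier_def)
    qed
    then have "C \<subseteq> F" using connected_subset_of_frontier_disjoint[OF C(1)] C(3) f by blast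
    then show False using C(4) t face_disjoint[OF F] drawing_split[OF e] e_img by auto
  qed
  have "g t \<in> frontier F" if "t \<in> {0<..<1}" for t
    using main[of t] that face_open[OF F] face_disjoint[OF F] drawing_split[OF e] e_img
    by (auto simp: frontier_def interior_open)
  then have "g ` closure {0<..<1} \<subseteq> frontier F"
    by (intro image_closure_subset) (auto simp: cont)
  then show ?thesis using e_img by simp
qed

text \<open>As in the proof of the Jordan curve theorem: an arc \<open>d\<close> through \<open>F3\<close> between two inner points
  of the edge splits the drawing into two parts with intersection \<open>d\<close>. Neither part separates
  \<open>F1\<close> from \<open>F2\<close>, hence neither does their union.\<close>

lemma edge_at_most_two_faces:
  assumes e: "e \<in> E" and F: "F1 \<in> faces V E" "F2 \<in> faces V E" "F3 \<in> faces V E"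
    and fr: "e \<subseteq> frontier F1" "e \<subseteq> frontier F2" "e \<subseteq> frontier F3"
  shows "F1 = F2 \<or> F1 = F3 \<or> F2 = F3"
proof (rule ccontr)
  assume neq: "\<not> ?thesis"
  obtain g where g: "arc g" "path_image g = e" "e \<inter> rest e = {g 0, g 1}" "e \<inter> V = {g 0, g 1}"
    by (rule edge_arc[OF e])
  have inj: "inj_on g {0..1}" and cont: "continuous_on {0..1} g"
    using g(1) unfolding arc_def path_def by auto
  have e_img: "e = g ` {0..1}" using g(2) unfolding path_image_def by simp
  define U where "U = frontier F3 - rest e"
  have inU: "g t \<in> U" if "0 < t" "t < 1" for t
  proof -
    have "g t \<in> e" using that e_img by auto
    moreover have "g t \<noteq> g 0" "g t \<noteq> g 1"
      using inj_onD[OF inj, of t 0] inj_onD[OF inj, of t 1] that by auto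
    ultimately show ?thesis using fr(3) g(3) unfolding U_def by blast
  qed
  have Uin: "\<exists>t. 0 < t \<and> t < 1 \<and> z = g t" if "z \<in> U" for z
  proof -
    have "z \<in> e" using that face_frontier[OF F(3)] drawing_split[OF e] unfolding U_def by auto
    then obtain t where t: "t \<in> {0..1}" "z = g t" using e_img by auto
    have "t \<noteq> 0" "t \<noteq> 1" using t that g(3) unfolding U_def by auto
    then show ?thesis using t by (intro exI[of _ t]) auto
  qed
  have opU: "openin (top_of_set (frontier F3)) U"
    unfolding U_def by (metis closed_rest Diff_eq openin_open_Int open_Compl)
  \<comment> \<open>The result on accessible points asks for two different open sets for the ends of
    the arc; deleting one point of \<open>U\<close> provides the second.\<close>
  have opU': "openin (top_of_set (frontier F3)) (U - {g (1/2)})"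
    using opU openin_delete by blast
  have diff: "g (1/2) \<noteq> g (1/3)" using inj_onD[OF inj, of "1/2" "1/3"] by auto
  obtain d where d: "arc d" "pathstart d \<in> U" "pathfinish d \<in> U - {g (1/2)}" "d ` {0<..<1} \<subseteq> F3"
  proof (rule dense_accessible_frontier_point_pairs[OF face_open[OF F(3)] face_connected[OF F(3)] opU opU'])
    show "U \<noteq> {}" "U - {g (1/2)} \<noteq> {}" "U \<noteq> U - {g (1/2)}"
      using inU[of "1/2"] inU[of "1/3"] diff by auto
  qed
  define D where "D = path_image d"
  have D: "compact D" "connected D" unfolding D_def using d(1) by (auto simp: compact_arc_image connected_arc_image)
  have Dsub: "D \<subseteq> insert (pathstart d) (insert (pathfinish d) F3)"
  proof
    fix z assume "z \<in> D"
    then obtain s where s: "s \<in> {0..1}" "z = d s" unfolding D_def path_image_def by auto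
    then show "z \<in> insert (pathstart d) (insert (pathfinish d) F3)"
      using d(4) unfolding pathstart_def pathfinish_def
      by (cases "s = 0"; cases "s = 1") (auto simp: image_subset_iff)
  qed
  obtain s t where st: "0 < s" "s < t" "t < 1" "D \<subseteq> {g s, g t} \<union> F3" "g s \<in> D" "g t \<in> D"
  proof -
    obtain a where a: "0 < a" "a < 1" "pathstart d = g a" using Uin[OF d(2)] by auto
    obtain b where b: "0 < b" "b < 1" "pathfinish d = g b" using Uin[of "pathfinish d"] d(3) by auto
    have ab: "a \<noteq> b" using arc_distinct_ends[OF d(1)] a b by auto
    have "g a \<in> D" "g b \<in> D" unfolding D_def a(3)[symmetric] b(3)[symmetric] by auto
    then show thesis using that[of a b] that[of b a] ab a b Dsub by (cases "a < b") (auto simp: insert_commute)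
  qed
  \<comment> \<open>\<open>S\<close> is the drawing without the piece of \<open>e\<close> strictly
    between \<open>g s\<close> and \<open>g t\<close>, plus \<open>D\<close>; \<open>T\<close> is
    that piece closed up by \<open>D\<close>.\<close>
  define S T where "S = (rest e \<union> g ` {0..s} \<union> g ` {t..1}) \<union> D" and "T = g ` {s..t} \<union> D"
  have cimg: "compact (g ` {a..b})" if "0 \<le> a" "b \<le> 1" for a b
    by (rule compact_continuous_image[OF continuous_on_subset[OF cont]]) (use that in auto)
  have "compact S" "compact T" unfolding S_def T_def using cimg st D compact_rest
    by (auto intro!: compact_Un)
  have "S \<inter> T = D"
  proof -
    have "z \<in> D" if z: "z \<in> rest e \<union> g ` {0..s} \<union> g ` {t..1}" "z \<in> g ` {s..t}" for z
    proof -
      obtain r where r: "s \<le> r" "r \<le> t" "z = g r" using z(2) by auto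
      have "z \<in> U" using inU[of r] r st by auto
      then have "z \<notin> rest e" unfolding U_def by auto
      then have "z \<in> g ` ({0..s} \<union> {t..1})" using z(1) by (simp add: image_Un)
      then obtain r' where r': "r' \<in> {0..s} \<union> {t..1}" "z = g r'" by (elim imageE)
      have "r = r'" by (rule inj_onD[OF inj]) (use r r' st in auto)
      then have "r = s \<or> r = t" using r r' by auto
      then show ?thesis using r st by auto
    qed
    then show ?thesis unfolding S_def T_def by blast
  qed
  obtain x y where xy: "x \<in> F1" "y \<in> F2" using face_nonempty F by blast
  \<comment> \<open>\<open>F1\<close> and \<open>F2\<close> both have \<open>m\<close> on their
    frontier and avoid \<open>Q\<close>, so they are joined through \<open>m\<close> as soon as
    \<open>Q\<close> misses this one point of \<open>e\<close>. For \<open>S\<close> the midpoint of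
    the removed piece will do, for \<open>T\<close> a point of \<open>e\<close> before
    \<open>g s\<close>.\<close>
  have conn: "connected_component (- Q) x y"
    if m: "m \<notin> Q" "m \<in> e" and Q: "Q \<subseteq> drawing \<union> D" for m Q
  proof -
    have c: "connected (insert m F1)" "connected (insert m F2)"
      by (rule connected_intermediate_closure[OF face_connected[OF F(1)]]
          connected_intermediate_closure[OF face_connected[OF F(2)]];
          use m(2) fr(1,2) closure_subset[of F1] closure_subset[of F2] in \<open>auto simp: frontier_def\<close>)+
    have "connected (insert m F1 \<union> insert m F2)"
      by (rule connected_Un[OF c]) auto
    moreover have "F1 \<inter> Q = {}" "F2 \<inter> Q = {}"
    proof -
      have gst: "g s \<in> drawing" "g t \<in> drawing" using st drawing_split[OF e] e_img by auto
      have "F1 \<inter> F3 = {}" "F2 \<inter> F3 = {}" using neq faces_disjoint F by auto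
      then show "F1 \<inter> Q = {}" "F2 \<inter> Q = {}"
        using face_disjoint[OF F(1)] face_disjoint[OF F(2)] Q st(4) gst by blast+
    qed
    ultimately show ?thesis unfolding connected_component_def
      using m xy by (intro exI[of _ "insert m F1 \<union> insert m F2"]) auto
  qed
  have notD: "g r \<notin> D" if "0 < r" "r < 1" "r \<noteq> s" "r \<noteq> t" for r
  proof
    assume "g r \<in> D"
    then have "g r = g s \<or> g r = g t \<or> g r \<in> F3" using st(4) by auto
    moreover have "g r \<notin> F3" using face_disjoint[OF F(3)] drawing_split[OF e] e_img that by auto
    ultimately show False using inj_onD[OF inj, of r s] inj_onD[OF inj, of r t] that st by auto
  qed
  note notimg = inj_on_unit_notin_image[OF inj]
  have "connected_component (- S) x y"
  proof (rule conn)
    show "g ((s+t)/2) \<notin> S"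
      unfolding S_def using notD[of "(s+t)/2"] notimg[of "(s+t)/2" 0 s] notimg[of "(s+t)/2" t 1]
        inU[of "(s+t)/2"] st by (simp add: U_def del: image_iff)
    show "g ((s+t)/2) \<in> e" using e_img st by auto
    show "S \<subseteq> drawing \<union> D" unfolding S_def drawing_split[OF e] e_img using st by auto
  qed
  moreover have "connected_component (- T) x y"
  proof (rule conn)
    show "g (s/2) \<notin> T"
      unfolding T_def using notD[of "s/2"] notimg[of "s/2" s t] st
      by (simp del: image_iff)
    show "g (s/2) \<in> e" using e_img st by auto
    show "T \<subseteq> drawing \<union> D" unfolding T_def drawing_split[OF e] e_img using st by auto
  qed
  ultimately have "connected_component (- (S \<union> T)) x y"
    using \<open>compact S\<close> \<open>compact T\<close> \<open>S \<inter> T = D\<close> D by (intro Janiszewski) (auto simp: compact_imp_closed)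
  then obtain C where C: "connected C" "C \<subseteq> - (S \<union> T)" "x \<in> C" "y \<in> C"
    unfolding connected_component_def by blast
  have "drawing \<subseteq> S \<union> T"
  proof -
    have "{0..1} \<subseteq> {0..s} \<union> {s..t} \<union> {t..1}" by auto
    then show ?thesis unfolding S_def T_def drawing_split[OF e] e_img by blast
  qed
  \<comment> \<open>\<open>frontier F1\<close> is part of the drawing, which \<open>C\<close>
    avoids; so \<open>C\<close> cannot leave \<open>F1\<close>, although it contains a point of
    \<open>F2\<close>.\<close>
  then have "C \<subseteq> F1"
    using C face_frontier[OF F(1)] xy by (intro connected_subset_of_frontier_disjoint) auto
  then show False using C(4) xy faces_disjoint[OF F(1,2)] neq by auto
qed


section \<open>Faces near an edge or a vertex\<close>

text \<open>On its way from \<open>F\<close> to \<open>e\<close> the set \<open>B\<close> crosses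
  \<open>frontier F\<close> in a point of the drawing, which can only be an inner point of
  \<open>e\<close>; by \<open>edge_in_frontier\<close> one such point is enough.\<close>

lemma edge_in_frontier_near:
  assumes e: "e \<in> E" and F: "F \<in> faces V E"
    and B: "connected B" "B \<inter> rest e = {}" "B \<inter> e \<noteq> {}" "B \<inter> F \<noteq> {}"
  shows "e \<subseteq> frontier F"
proof -
  have "\<not> B \<subseteq> F" using B(3) face_disjoint[OF F] drawing_split[OF e] by blast
  then have "B \<inter> frontier F \<noteq> {}" using B(1,4) by (intro connected_Int_frontier) auto
  then obtain q where q: "q \<in> B" "q \<in> frontier F" by auto
  then have "q \<in> e" "q \<notin> rest e" using face_frontier[OF F] drawing_split[OF e] B(2) by auto
  then show ?thesis using edge_in_frontier[OF F e q(2)] by simp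
qed

lemma edge_interior_ball:
  assumes "e \<in> E"
  obtains p \<epsilon> where "p \<in> e" "\<epsilon> > 0" "ball p \<epsilon> \<inter> rest e = {}"
proof -
  obtain p where p: "p \<in> e" "p \<notin> rest e" using edge_interior_point[OF assms] by blast
  have "open (- rest e)" "p \<in> - rest e" using closed_rest p by auto
  then obtain \<epsilon> where "\<epsilon> > 0" "ball p \<epsilon> \<subseteq> - rest e" using open_contains_ball by blast
  then show thesis using that[of p \<epsilon>] p by blast
qed

lemma edge_has_face:
  assumes e: "e \<in> E"
  obtains F where "F \<in> faces V E" "e \<subseteq> frontier F"
proof -
  obtain p \<epsilon> where p: "p \<in> e" "\<epsilon> > 0" "ball p \<epsilon> \<inter> rest e = {}" by (rule edge_interior_ball[OF e])
  obtain g where "arc g" "path_image g = e" by (rule edge_arc[OF e])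
  then have "interior e = {}" using interior_arc_image_empty by blast
  then have "\<not> ball p \<epsilon> \<subseteq> e"
    using interior_maximal[OF _ open_ball, of p \<epsilon> e] p(2) by auto
  then obtain z where z: "z \<in> ball p \<epsilon>" "z \<notin> e" by blast
  then have "z \<notin> drawing" using p(3) drawing_split[OF e] by auto
  then obtain F where F: "F \<in> faces V E" "z \<in> F" by (rule obtain_face)
  have "e \<subseteq> frontier F"
    by (rule edge_in_frontier_near[OF e F(1) connected_ball p(3)]) (use p z F centre_in_ball in blast)+
  then show thesis using that F by blast
qed

text \<open>By the Jordan curve theorem a point of \<open>e\<close> is on the frontier of both the
  inside and the outside of \<open>c\<close>, so both sides have a face along \<open>e\<close>.
  These differ because a face cannot cross \<open>c\<close>, and hence one of them is not the given
  \<open>F\<close>.\<close>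

lemma closed_curve_other_face:
  assumes e: "e \<in> E" and c: "simple_path c" "pathfinish c = pathstart c"
    and ec: "e \<subseteq> path_image c" "path_image c \<subseteq> drawing"
  obtains F' where "F' \<in> faces V E" "F' \<noteq> F" "e \<subseteq> frontier F'"
proof -
  obtain p \<epsilon> where p: "p \<in> e" "\<epsilon> > 0" "ball p \<epsilon> \<inter> rest e = {}" by (rule edge_interior_ball[OF e])
  have J: "frontier (inside (path_image c)) = path_image c" "frontier (outside (path_image c)) = path_image c"
    "inside (path_image c) \<inter> outside (path_image c) = {}"
    "inside (path_image c) \<union> outside (path_image c) = - path_image c"
    using Jordan_inside_outside[OF c] by auto
  have face: "\<exists>F z. F \<in> faces V E \<and> z \<in> F \<and> z \<in> A \<and> e \<subseteq> frontier F"
    if A: "frontier A = path_image c" "A \<inter> path_image c = {}" for A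
  proof -
    have "p \<in> closure A" using p ec A by (auto simp: frontier_def)
    then obtain z where z: "z \<in> A" "z \<in> ball p \<epsilon>"
      using closure_approachable[of p A] p(2) by (auto simp: dist_commute)
    then have "z \<notin> drawing" using p(3) drawing_split[OF e] ec A(2) by auto
    then obtain F where F: "F \<in> faces V E" "z \<in> F" by (rule obtain_face)
    have "e \<subseteq> frontier F"
      by (rule edge_in_frontier_near[OF e F(1) connected_ball p(3)]) (use p z F centre_in_ball in blast)+
    then show ?thesis using F z by blast
  qed
  obtain F1 z1 where 1: "F1 \<in> faces V E" "z1 \<in> F1" "z1 \<in> inside (path_image c)" "e \<subseteq> frontier F1"
    using face[OF J(1)] J(4) by blast
  obtain F2 z2 where 2: "F2 \<in> faces V E" "z2 \<in> F2" "z2 \<in> outside (path_image c)" "e \<subseteq> frontier F2"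
    using face[OF J(2)] J(4) by blast
  have "F1 \<subseteq> inside (path_image c)"
    by (rule connected_subset_of_frontier_disjoint[OF face_connected[OF 1(1)]])
      (use 1 J(1) face_disjoint[OF 1(1)] ec in auto)
  then have "F1 \<noteq> F2" using 2 J(3) by blast
  then show thesis using that 1 2 by metis
qed

text \<open>A small punctured disc around \<open>x\<close> is connected and meets only edges at
  \<open>x\<close>. If none of these were on \<open>frontier F\<close>, the disc would lie in
  \<open>F\<close>, yet \<open>e0\<close> enters it.\<close>

lemma vertex_frontier_edge:
  assumes F: "F \<in> faces V E" and x: "x \<in> V" "x \<in> frontier F" and e0: "e0 \<in> E" "x \<in> e0"
  obtains e where "e \<in> E" "x \<in> e" "e \<subseteq> frontier F"
proof (rule ccontr)
  assume none: "\<not> thesis"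
  define C where "C = (V - {x}) \<union> \<Union>{e \<in> E. x \<notin> e}"
  have "compact C" unfolding C_def
    by (intro compact_Un[OF finite_imp_compact] compact_Union) (auto simp: finite_V finite_E compact_edge)
  then have "open (- C)" by (simp add: compact_imp_closed open_Compl)
  moreover have "x \<in> - C" by (simp add: C_def)
  ultimately obtain \<epsilon> where \<epsilon>: "\<epsilon> > 0" "ball x \<epsilon> \<subseteq> - C" using open_contains_ball by blast
  define B where "B = ball x \<epsilon> - {x}"
  have conB: "connected B" unfolding B_def by (rule connected_open_delete) auto
  have "B \<inter> frontier F = {}"
  proof (rule ccontr)
    assume "B \<inter> frontier F \<noteq> {}"
    then obtain z where z: "z \<in> ball x \<epsilon>" "z \<noteq> x" "z \<in> frontier F" unfolding B_def by blast
    then have zC: "z \<notin> C" "z \<in> drawing" using \<epsilon>(2) face_frontier[OF F] by auto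
    then obtain e where e: "e \<in> E" "z \<in> e" "x \<in> e" "z \<notin> V"
      unfolding C_def drawing_def using z(2) by auto
    have "z \<notin> rest e" using edge_Int e unfolding rest_def by blast
    then have "e \<subseteq> frontier F" using edge_in_frontier[OF F e(1) z(3) e(2)] by simp
    then show False using none that e by blast
  qed
  moreover have "B \<inter> F \<noteq> {}"
  proof -
    have "x \<in> closure F" using x by (auto simp: frontier_def)
    then obtain z where "z \<in> F" "z \<in> ball x \<epsilon>"
      using closure_approachable[of x F] \<epsilon>(1) by (auto simp: dist_commute)
    moreover have "x \<notin> F" using face_disjoint[OF F] x(1) by (auto simp: drawing_def)
    ultimately show ?thesis unfolding B_def by auto
  qed
  ultimately have "B \<subseteq> F" using connected_subset_of_frontier_disjoint[OF conB] by blast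
  moreover have "\<exists>z \<in> e0. z \<in> B"
  proof -
    obtain p where "p \<in> e0" "p \<notin> rest e0" by (rule edge_interior_point[OF e0(1)])
    moreover have "x \<in> rest e0" using x unfolding rest_def by simp
    ultimately have "e0 \<noteq> {z}" for z using e0(2) by auto
    then have "x islimpt e0" by (rule connected_imp_perfect[OF connected_edge[OF e0(1)] e0(2)])
    then show ?thesis unfolding islimpt_approachable B_def using \<epsilon>(1) by (auto simp: dist_commute)
  qed
  ultimately show False using face_disjoint[OF F] edge_subset_drawing[OF e0(1)] by blast
qed

lemma frontier_eq_Union_incident_edges:
  assumes F: "F \<in> faces V E" and V: "\<And>v. v \<in> V \<Longrightarrow> \<exists>e\<in>E. v \<in> e"
  shows "frontier F = \<Union>(incident_edges E F)"
proof
  show "frontier F \<subseteq> \<Union>(incident_edges E F)"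
  proof
    fix z assume z: "z \<in> frontier F"
    show "z \<in> \<Union>(incident_edges E F)"
    proof (cases "z \<in> V")
      case True
      then obtain e0 where "e0 \<in> E" "z \<in> e0" using V by blast
      with vertex_frontier_edge[OF F True z] show ?thesis
        unfolding incident_edges_def by blast
    next
      case False
      then obtain e where e: "e \<in> E" "z \<in> e"
        using z face_frontier[OF F] unfolding drawing_def by blast
      then have "z \<notin> rest e" using edge_Int False unfolding rest_def by blast
      then show ?thesis using edge_in_frontier[OF F e(1) z e(2)] e unfolding incident_edges_def by blast
    qed
  qed
qed (auto simp: incident_edges_def)

section \<open>Forests, face boundaries and links\<close>

text \<open>The second hypothesis says that \<open>H\<close> is a forest: every non-empty part has a
  leaf. A leaf edge meets the other edges in at most one point, so adding it back keeps the
  complement connected by Janiszewski's theorem.\<close>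

lemma connected_Compl_forest:
  assumes "H \<subseteq> E"
    and "\<And>H'. H' \<subseteq> H \<Longrightarrow> H' \<noteq> {} \<Longrightarrow> \<exists>e\<in>H'. \<exists>v\<in>e \<inter> V. \<forall>d\<in>H' - {e}. v \<notin> d"
  shows "connected (- \<Union>H)"
proof -
  have "finite H" using assms(1) finite_E finite_subset by blast
  then show ?thesis using assms
  proof (induction "card H" arbitrary: H)
    case 0
    then show ?case by (simp add: connected_UNIV)
  next
    case (Suc n)
    then have "H \<noteq> {}" by auto
    then obtain e v where e: "e \<in> H" "v \<in> e \<inter> V" "\<forall>d\<in>H - {e}. v \<notin> d"
      using Suc.prems(3)[of H] by blast
    have eE: "e \<in> E" using e Suc.prems by auto
    have conn: "connected (- \<Union>(H - {e}))"
    proof (rule Suc.hyps(1))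
      show "n = card (H - {e})" using Suc.hyps(2) e(1) Suc.prems(1) by simp
      show "finite (H - {e})" "H - {e} \<subseteq> E" using Suc.prems by auto
      show "\<exists>e\<in>H'. \<exists>v\<in>e \<inter> V. \<forall>d\<in>H' - {e}. v \<notin> d" if "H' \<subseteq> H - {e}" "H' \<noteq> {}" for H'
        using Suc.prems(3)[of H'] that by blast
    qed
    obtain g where g: "e \<inter> V = {g (0::real), g 1}" by (rule edge_arc[OF eE])
    have "e \<inter> \<Union>(H - {e}) \<subseteq> e \<inter> V - {v}"
      using e(3) edge_Int[OF eE] Suc.prems(2) by blast
    then obtain u where "e \<inter> \<Union>(H - {e}) \<subseteq> {u}" using g e(2) by (cases "v = g 0") auto
    then have "connected (e \<inter> \<Union>(H - {e}))" by (metis connected_empty connected_sing subset_singletonD)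
    moreover have "closed (\<Union>(H - {e}))"
      using Suc.prems by (intro closed_Union) (auto simp: compact_edge compact_imp_closed)
    ultimately have "connected (- (e \<union> \<Union>(H - {e})))"
      using Janiszewski_connected[OF compact_edge[OF eE]] conn connected_Compl_edge[OF eE] by blast
    moreover have "e \<union> \<Union>(H - {e}) = \<Union>H" using e(1) by auto
    ultimately show ?case by simp
  qed
qed

lemma edges_eq_of_cover:
  assumes "H \<subseteq> E" "drawing \<subseteq> \<Union>H"
  shows "H = E"
proof -
  have "e \<in> H" if e: "e \<in> E" for e
  proof -
    obtain p where p: "p \<in> e" "p \<notin> rest e" by (rule edge_interior_point[OF e])
    then obtain h where h: "h \<in> H" "p \<in> h" using assms(2) edge_subset_drawing[OF e] by blast
    then have "h = e" using p assms(1) unfolding rest_def by blast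
    then show ?thesis using h by simp
  qed
  then show ?thesis using assms(1) by auto
qed

text \<open>\<open>H\<close> has minimum degree two and stands in for a cycle. Without such an
  \<open>H\<close> the boundary is a forest, so its complement is connected, meets \<open>F\<close>
  and avoids \<open>frontier F\<close>. Then it lies in \<open>F\<close>, and the whole drawing
  consists of boundary edges.\<close>

lemma face_boundary_cyclic:
  assumes F: "F \<in> faces V E" and V: "\<And>v. v \<in> V \<Longrightarrow> \<exists>e\<in>E. v \<in> e"
    and ne: "incident_edges E F \<noteq> E"
  obtains H where "H \<subseteq> incident_edges E F" "H \<noteq> {}"
    "\<forall>e\<in>H. \<forall>v\<in>e \<inter> V. \<exists>d\<in>H - {e}. v \<in> d"
proof (rule ccontr)
  let ?H = "incident_edges E F"
  assume no: "\<not> thesis"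
  note cyclic = that
  have sub: "?H \<subseteq> E" unfolding incident_edges_def by auto
  have "\<exists>e\<in>H. \<exists>v\<in>e \<inter> V. \<forall>d\<in>H - {e}. v \<notin> d" if H: "H \<subseteq> ?H" "H \<noteq> {}" for H
  proof (rule ccontr)
    assume "\<not> ?thesis"
    then have "\<forall>e\<in>H. \<forall>v\<in>e \<inter> V. \<exists>d\<in>H - {e}. v \<in> d" by blast
    then show False using no cyclic[OF H] by blast
  qed
  then have "connected (- \<Union>?H)" by (rule connected_Compl_forest[OF sub])
  moreover have fr: "frontier F = \<Union>?H" by (rule frontier_eq_Union_incident_edges[OF F V])
  moreover have "- \<Union>?H \<inter> F \<noteq> {}"
    using face_nonempty[OF F] face_disjoint[OF F] face_frontier[OF F] fr by blast
  ultimately have "- \<Union>?H \<subseteq> F" by (intro connected_subset_of_frontier_disjoint) auto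
  then have "drawing \<subseteq> \<Union>?H" using face_disjoint[OF F] by auto
  then show False using ne edges_eq_of_cover[OF sub] by blast
qed

text \<open>The link of a vertex is connected: deleting the edges at \<open>x\<close> outside \<open>S\<close> would leave a
  face at \<open>x\<close> that contains a deleted edge, yet every edge of \<open>S\<close> already has two other faces.\<close>

lemma link_connected:
  assumes V: "\<And>v. v \<in> V \<Longrightarrow> \<exists>e\<in>E. v \<in> e" and x: "x \<in> V"
    and S: "S \<noteq> {}" "S \<subseteq> {e \<in> E. x \<in> e}"
    and two: "\<And>e. e \<in> S \<Longrightarrow> \<exists>F1\<in>faces V E. \<exists>F2\<in>faces V E. F1 \<noteq> F2 \<and> e \<subseteq> frontier F1 \<and> e \<subseteq> frontier F2"
    and closed: "\<And>F e d. F \<in> faces V E \<Longrightarrow> e \<in> S \<Longrightarrow> e \<subseteq> frontier F \<Longrightarrow> d \<in> E \<Longrightarrow> x \<in> d \<Longrightarrow> d \<subseteq> frontier F \<Longrightarrow> d \<in> S"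
  shows "S = {e \<in> E. x \<in> e}"
proof (rule ccontr)
  assume "S \<noteq> {e \<in> E. x \<in> e}"
  then obtain d where d: "d \<in> E" "x \<in> d" "d \<notin> S" using S by blast
  define E' where "E' = {e \<in> E. x \<in> e \<longrightarrow> e \<in> S}"
  have E'E: "E' \<subseteq> E" "d \<notin> E'" unfolding E'_def using d by auto
  interpret sub: plane V E'
  proof
    show "plane_graph V E'"
      using plane E'E unfolding plane_graph_def by (meson finite_subset subsetD)
  qed
  have drsub: "sub.drawing \<subseteq> drawing" "sub.drawing \<subseteq> rest d"
    using E'E unfolding sub.drawing_def drawing_def rest_def by auto
  \<comment> \<open>By \<open>closed\<close>, a face with one edge in \<open>S\<close> has all its
    edges at \<open>x\<close> in \<open>S\<close>. Its frontier survives the deletion, so it remains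
    a face of the smaller graph.\<close>
  have faceE': "F \<in> faces V E'" if F: "F \<in> faces V E" "e \<in> S" "e \<subseteq> frontier F" for F e
  proof -
    have "incident_edges E F \<subseteq> E'"
      using closed[OF F] unfolding incident_edges_def E'_def by auto
    moreover have "frontier F = \<Union>(incident_edges E F)"
      by (rule frontier_eq_Union_incident_edges[OF F(1) V])
    ultimately have fr: "frontier F \<subseteq> sub.drawing" unfolding sub.drawing_def by blast
    show ?thesis unfolding sub.faces_eq in_components_maximal
    proof (intro conjI allI impI)
      show "F \<noteq> {}" "connected F" using face_nonempty face_connected F by auto
      show "F \<subseteq> - sub.drawing" using face_disjoint[OF F(1)] drsub by auto
      fix D assume D: "D \<noteq> {} \<and> F \<subseteq> D \<and> D \<subseteq> - sub.drawing \<and> connected D"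
      then have "D \<subseteq> F"
        using face_nonempty[OF F(1)] fr by (intro connected_subset_of_frontier_disjoint) auto
      then show "D = F" using D by auto
    qed
  qed
  obtain g where g: "arc g" "path_image g = d" "d \<inter> rest d = {g 0, g 1}" "d \<inter> V = {g 0, g 1}"
    by (rule edge_arc[OF d(1)])
  have cont: "continuous_on {0..1} g" using g(1) unfolding arc_def path_def by auto
  have gd: "g t \<in> d" if "0 \<le> t" "t \<le> 1" for t using that g(2) unfolding path_image_def by auto
  have g_rest: "g t \<notin> rest d" if "0 < t" "t < 1" for t
  proof
    assume "g t \<in> rest d"
    then have "g t = g 0 \<or> g t = g 1" using g(3) gd[of t] that by auto
    then show False using arcD[OF g(1), of t 0] arcD[OF g(1), of t 1] that by auto
  qed
  have "g (1/2) \<notin> sub.drawing" using g_rest[of "1/2"] drsub by auto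
  then obtain F where F: "F \<in> faces V E'" "g (1/2) \<in> F" by (rule sub.obtain_face)
  have "connected (g ` {0<..<1})"
    by (rule connected_continuous_image[OF continuous_on_subset[OF cont]]) auto
  moreover have "g (1/2) \<in> g ` {0<..<1}" by (rule imageI) auto
  moreover have "g ` {0<..<1} \<inter> rest d = {}" using g_rest by auto
  ultimately have "g ` {0<..<1} \<subseteq> F"
    using F(2) sub.face_frontier[OF F(1)] drsub
    by (intro connected_subset_of_frontier_disjoint) blast+
  then have "g ` closure {0<..<1} \<subseteq> closure F"
    by (intro image_closure_subset) (use closure_subset[of F] in \<open>auto simp: cont\<close>)
  then have "d \<subseteq> closure F" using g(2) unfolding path_image_def by auto
  then have "x \<in> frontier F"
    using d(2) x sub.face_disjoint[OF F(1)] sub.face_open[OF F(1)]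
    unfolding frontier_def sub.drawing_def by (auto simp: interior_open)
  moreover obtain e0 where "e0 \<in> E'" "x \<in> e0" using S unfolding E'_def by blast
  ultimately obtain e where e: "e \<in> E'" "x \<in> e" "e \<subseteq> frontier F"
    by (rule sub.vertex_frontier_edge[OF F(1) x])
  then have eS: "e \<in> S" unfolding E'_def by auto
  \<comment> \<open>In the smaller graph \<open>e\<close> borders \<open>F1\<close>,
    \<open>F2\<close> and \<open>F\<close>, so \<open>F\<close> is one of the first two; but
    \<open>F\<close> contains an inner point of the deleted edge \<open>d\<close>, which faces of
    the original graph avoid.\<close>
  then obtain F1 F2 where F12: "F1 \<in> faces V E" "F2 \<in> faces V E" "F1 \<noteq> F2"
    "e \<subseteq> frontier F1" "e \<subseteq> frontier F2" using two[OF eS] by (elim bexE conjE)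
  then have "F = F1 \<or> F = F2"
    using sub.edge_at_most_two_faces[OF e(1) F(1) faceE'[OF F12(1) eS] faceE'[OF F12(2) eS] e(3)] by blast
  moreover have "g (1/2) \<in> drawing" using edge_subset_drawing[OF d(1)] gd[of "1/2"] by auto
  ultimately show False using F(2) face_disjoint[OF F12(1)] face_disjoint[OF F12(2)] by blast
qed

end

section \<open>Simple plane graphs\<close>

text \<open>An isolated vertex would belong to the frontier of a face without lying on any edge.
  Excluding it makes every frontier a union of edges; \<open>theorem7\<close> treats the remaining
  one-vertex graph directly.\<close>

locale simple_plane = plane +
  assumes simple: "simple_edges V E"
    and no_isolated: "v \<in> V \<Longrightarrow> \<exists>e\<in>E. v \<in> e"
begin

text \<open>From here on edges are replaced by their pairs of ends. Simplicity makes this faithful,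
  so degrees become cardinalities of sets of pairs, in the form in which \<open>wheel\<close> is
  stated.\<close>

definition edge_ends :: "complex set set" where
  "edge_ends = ends V ` E"

definition boundary :: "complex set \<Rightarrow> complex set set" where
  "boundary F = ends V ` incident_edges E F"

lemma inj_ends: "inj_on (ends V) E"
  using simple unfolding simple_edges_def .

lemma mem_ends: "v \<in> V \<Longrightarrow> v \<in> ends V e \<longleftrightarrow> v \<in> e"
  unfolding ends_def by auto

lemma incident_edges_subset: "incident_edges E F \<subseteq> E"
  unfolding incident_edges_def by auto

lemma ends_doubleton:
  assumes "e \<in> E"
  obtains a b where "a \<noteq> b" "a \<in> V" "b \<in> V" "ends V e = {a, b}"
proof -
  obtain g :: "real \<Rightarrow> complex" where g: "arc g" "path_image g = e" "e \<inter> rest e = {g 0, g 1}" "e \<inter> V = {g 0, g 1}"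
    by (rule edge_arc[OF assms])
  moreover have "g 0 \<noteq> g 1" using arcD[OF g(1), of 0 1] by auto
  moreover have "g 0 \<in> V" "g 1 \<in> V" using g(4) by blast+
  ultimately show thesis using that[of "g 0" "g 1"] by (simp add: ends_def)
qed

lemma edge_ends_doubleton:
  assumes "s \<in> edge_ends"
  obtains a b where "a \<noteq> b" "a \<in> V" "b \<in> V" "s = {a, b}"
  using assms ends_doubleton unfolding edge_ends_def by (metis imageE)

lemma edge_ends_subset: "s \<in> edge_ends \<Longrightarrow> s \<subseteq> V"
  by (erule edge_ends_doubleton) auto

lemma edge_ends_other:
  assumes "s \<in> edge_ends" "v \<in> s"
  obtains w where "w \<noteq> v" "w \<in> V" "v \<in> V" "s = {v, w}"
proof -
  obtain a b where "a \<noteq> b" "a \<in> V" "b \<in> V" "s = {a, b}" by (rule edge_ends_doubleton[OF assms(1)])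
  then show thesis using that[of b] that[of a] assms(2) by auto
qed

lemma pair_edge_ends: "{a, b} \<in> edge_ends \<Longrightarrow> a \<noteq> b \<and> a \<in> V \<and> b \<in> V"
  by (erule edge_ends_doubleton) (auto simp: doubleton_eq_iff)

lemma finite_edge_ends: "finite edge_ends"
  unfolding edge_ends_def using finite_E by simp

lemma boundary_subset: "boundary F \<subseteq> edge_ends"
  unfolding boundary_def edge_ends_def using incident_edges_subset by auto

lemma finite_boundary: "finite (boundary F)"
  using boundary_subset finite_edge_ends finite_subset by blast

lemma card_edge_ends: "card edge_ends = card E"
  unfolding edge_ends_def by (rule card_image[OF inj_ends])

lemma face_degree_eq: "face_degree E F = card (boundary F)"
  unfolding face_degree_def boundary_def
  by (rule card_image[symmetric], rule inj_on_subset[OF inj_ends incident_edges_subset])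

lemma vertex_degree_eq:
  assumes "v \<in> V"
  shows "vertex_degree E v = card {s \<in> edge_ends. v \<in> s}"
proof -
  have "{s \<in> edge_ends. v \<in> s} = ends V ` {e \<in> E. v \<in> e}"
    unfolding edge_ends_def using mem_ends[OF assms] by auto
  moreover have "inj_on (ends V) {e \<in> E. v \<in> e}" by (rule inj_on_subset[OF inj_ends]) auto
  ultimately show ?thesis unfolding vertex_degree_def by (simp add: card_image)
qed

lemma ends_in_boundary:
  assumes "e \<in> E"
  shows "ends V e \<in> boundary F \<longleftrightarrow> e \<subseteq> frontier F"
  unfolding boundary_def
  using inj_on_image_mem_iff[OF inj_ends assms incident_edges_subset] assms
  by (auto simp: incident_edges_def)

lemma vertex_in_frontier:
  assumes F: "F \<in> faces V E" and v: "v \<in> V"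
  shows "v \<in> frontier F \<longleftrightarrow> v \<in> \<Union>(boundary F)"
proof -
  have "frontier F = \<Union>(incident_edges E F)"
    by (rule frontier_eq_Union_incident_edges[OF F no_isolated])
  then show ?thesis unfolding boundary_def using mem_ends[OF v] by auto
qed

lemma at_most_two_faces:
  assumes "F1 \<in> faces V E" "F2 \<in> faces V E" "F3 \<in> faces V E"
    and "s \<in> boundary F1" "s \<in> boundary F2" "s \<in> boundary F3"
  shows "F1 = F2 \<or> F1 = F3 \<or> F2 = F3"
proof -
  have "s \<in> edge_ends" using boundary_subset assms(4) by auto
  then obtain e where e: "e \<in> E" "s = ends V e" unfolding edge_ends_def by auto
  show ?thesis
    by (rule edge_at_most_two_faces[OF e(1) assms(1-3)]) (use assms(4-6) ends_in_boundary[OF e(1)] e(2) in auto)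
qed

lemma edge_ends_has_face:
  assumes "s \<in> edge_ends"
  obtains F where "F \<in> faces V E" "s \<in> boundary F"
proof -
  obtain e where e: "e \<in> E" "s = ends V e" using assms unfolding edge_ends_def by auto
  obtain F where "F \<in> faces V E" "e \<subseteq> frontier F" by (rule edge_has_face[OF e(1)])
  then show thesis using that[of F] ends_in_boundary[OF e(1)] e(2) by auto
qed

lemma boundary_cyclic:
  assumes F: "F \<in> faces V E" and ne: "boundary F \<noteq> edge_ends"
  obtains H where "H \<subseteq> boundary F" "H \<noteq> {}" "\<forall>s\<in>H. \<forall>v\<in>s. \<exists>t\<in>H - {s}. v \<in> t"
proof -
  have ne': "incident_edges E F \<noteq> E" using ne unfolding boundary_def edge_ends_def by auto
  obtain H where H: "H \<subseteq> incident_edges E F" "H \<noteq> {}"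
    and cyc: "\<forall>e\<in>H. \<forall>v\<in>e \<inter> V. \<exists>d\<in>H - {e}. v \<in> d"
    by (rule face_boundary_cyclic[OF F no_isolated ne'])
  have HE: "H \<subseteq> E" using H incident_edges_subset by auto
  have "\<exists>t\<in>ends V ` H - {s}. v \<in> t" if s: "s \<in> ends V ` H" "v \<in> s" for s v
  proof -
    obtain e where e: "e \<in> H" "s = ends V e" using s by auto
    then have v: "v \<in> e \<inter> V" using s unfolding ends_def by auto
    then obtain d where d: "d \<in> H" "d \<noteq> e" "v \<in> d" using cyc e(1) by blast
    then have "ends V d \<noteq> s" using e HE inj_onD[OF inj_ends, of d e] by auto
    then show ?thesis using d v by (intro bexI[of _ "ends V d"]) (auto simp: ends_def)
  qed
  moreover have "ends V ` H \<subseteq> boundary F" "ends V ` H \<noteq> {}" using H unfolding boundary_def by auto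
  ultimately show thesis using that[of "ends V ` H"] by blast
qed

lemma link_connected_ends:
  assumes x: "x \<in> V" and S: "S \<noteq> {}" "S \<subseteq> {s \<in> edge_ends. x \<in> s}"
    and two: "\<And>s. s \<in> S \<Longrightarrow> \<exists>F1\<in>faces V E. \<exists>F2\<in>faces V E. F1 \<noteq> F2 \<and> s \<in> boundary F1 \<and> s \<in> boundary F2"
    and closed: "\<And>F s t. F \<in> faces V E \<Longrightarrow> s \<in> S \<Longrightarrow> s \<in> boundary F \<Longrightarrow> t \<in> boundary F \<Longrightarrow> x \<in> t \<Longrightarrow> t \<in> S"
  shows "S = {s \<in> edge_ends. x \<in> s}"
proof -
  define S' where "S' = {e \<in> E. ends V e \<in> S}"
  have S_eq: "S = ends V ` S'" using S(2) unfolding S'_def edge_ends_def by auto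
  have "S' = {e \<in> E. x \<in> e}"
  proof (rule link_connected[OF no_isolated x])
    show "S' \<noteq> {}" using S(1) S_eq by auto
    show "S' \<subseteq> {e \<in> E. x \<in> e}" using S(2) mem_ends[OF x] unfolding S'_def by auto
    show "\<exists>F1\<in>faces V E. \<exists>F2\<in>faces V E. F1 \<noteq> F2 \<and> e \<subseteq> frontier F1 \<and> e \<subseteq> frontier F2"
      if "e \<in> S'" for e
      using two[of "ends V e"] that ends_in_boundary[of e] unfolding S'_def by auto
    show "d \<in> S'" if "F \<in> faces V E" "e \<in> S'" "e \<subseteq> frontier F" "d \<in> E" "x \<in> d" "d \<subseteq> frontier F" for F e d
      using closed[of F "ends V e" "ends V d"] that ends_in_boundary[of e] ends_in_boundary[of d] mem_ends[OF x]
      unfolding S'_def by auto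
  qed
  moreover have "{s \<in> edge_ends. x \<in> s} = ends V ` {e \<in> E. x \<in> e}"
    unfolding edge_ends_def using mem_ends[OF x] by auto
  ultimately show ?thesis using S_eq by simp
qed

section \<open>Triangular face boundaries\<close>

text \<open>From an edge \<open>{a, b}\<close> of \<open>H\<close>, minimum degree two yields
  further edges \<open>{b, c}\<close> and \<open>{a, d}\<close>, and these three already fill
  \<open>B\<close>. The second edge at \<open>c\<close> must then be \<open>{a, d}\<close>, so
  \<open>d = c\<close>.\<close>

lemma cyclic_triangle:
  assumes H: "H \<subseteq> edge_ends" "H \<noteq> {}" "finite B" "H \<subseteq> B" "card B \<le> 3"
    and cyc: "\<forall>s\<in>H. \<forall>v\<in>s. \<exists>t\<in>H - {s}. v \<in> t"
  obtains a b c where "a \<noteq> b" "b \<noteq> c" "a \<noteq> c" "B = {{a, b}, {b, c}, {c, a}}"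
proof -
  obtain s where s: "s \<in> H" using H by auto
  then obtain a b where ab: "a \<noteq> b" "s = {a, b}" using H(1) edge_ends_doubleton by blast
  obtain t where t: "t \<in> H" "t \<noteq> s" "b \<in> t" using cyc s ab by blast
  obtain c where c: "c \<noteq> b" "t = {b, c}" using t H(1) edge_ends_other[of t b] by blast
  have ca: "c \<noteq> a" using c t(2) ab by (auto simp: insert_commute)
  obtain u where u: "u \<in> H" "u \<noteq> s" "a \<in> u" using cyc s ab by blast
  obtain d where d: "d \<noteq> a" "u = {a, d}" using u H(1) edge_ends_other[of u a] by blast
  have "u \<noteq> t" using u c ca ab by auto
  then have "card {s, t, u} = 3" using t u by auto
  moreover have "{s, t, u} \<subseteq> B" using s t u H by auto
  ultimately have B: "B = {s, t, u}" using H(3,5) card_seteq by metis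
  obtain w where w: "w \<in> H" "w \<noteq> t" "c \<in> w" using cyc t(1) c by blast
  then have "w \<in> B" using H(4) by auto
  then have "w = u" using w B ab c ca by auto
  then have "d = c" using w d ca by auto
  then have "B = {{a, b}, {b, c}, {c, a}}" using B ab(2) c(2) d(2) by (simp add: insert_commute)
  then show thesis using that ab(1) c(1) ca by metis
qed

text \<open>The bound is an inequality so that the lemma also rules out boundaries with fewer than
  three edges: a triangle has exactly three.\<close>

lemma boundary_card_le_3_triangle:
  assumes "F \<in> faces V E" "boundary F \<noteq> edge_ends" "card (boundary F) \<le> 3"
  obtains a b c where "a \<noteq> b" "b \<noteq> c" "a \<noteq> c" "boundary F = {{a, b}, {b, c}, {c, a}}"
proof -
  obtain H where H: "H \<subseteq> boundary F" "H \<noteq> {}" "\<forall>s\<in>H. \<forall>v\<in>s. \<exists>t\<in>H - {s}. v \<in> t"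
    by (rule boundary_cyclic[OF assms(1,2)])
  have "H \<subseteq> edge_ends" using H(1) boundary_subset by (rule order_trans)
  then show thesis using that by (rule cyclic_triangle[OF _ H(2) finite_boundary H(1) assms(3) H(3)])
qed

lemma edge_arc_between:
  assumes "e \<in> E" "ends V e = {a, b}" "a \<noteq> b"
  obtains g where "arc g" "path_image g = e" "pathstart g = a" "pathfinish g = b"
proof -
  obtain g where g: "arc g" "path_image g = e" "e \<inter> V = {g 0, g 1}" by (rule edge_arc[OF assms(1)])
  then have "{g 0, g 1} = {a, b}" using assms unfolding ends_def by auto
  then consider "g 0 = a" "g 1 = b" | "g 0 = b" "g 1 = a" by (auto simp: doubleton_eq_iff)
  then show thesis
  proof cases
    case 1
    then show ?thesis using that[of g] g by (simp add: pathstart_def pathfinish_def)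
  next
    case 2
    then have "pathstart (reversepath g) = a" "pathfinish (reversepath g) = b"
      by (simp_all add: pathstart_def pathfinish_def reversepath_def)
    then show ?thesis using that[of "reversepath g"] g by (simp add: arc_reversepath)
  qed
qed

lemma edge_Int_ends: "e \<in> E \<Longrightarrow> e' \<in> E \<Longrightarrow> e \<noteq> e' \<Longrightarrow> e \<inter> e' = ends V e \<inter> ends V e'"
  using edge_Int[of e e'] unfolding ends_def by auto

lemma triangle_curve:
  assumes E: "e1 \<in> E" "e2 \<in> E" "e3 \<in> E"
    and ends: "ends V e1 = {a, b}" "ends V e2 = {b, c}" "ends V e3 = {c, a}"
    and d: "a \<noteq> b" "b \<noteq> c" "a \<noteq> c"
  obtains p where "simple_path p" "pathfinish p = pathstart p" "path_image p = e1 \<union> e2 \<union> e3"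
proof -
  have "e1 \<noteq> e2" "e1 \<noteq> e3" "e2 \<noteq> e3" using ends d by (auto simp: doubleton_eq_iff)
  then have i: "e1 \<inter> e2 = {b}" "e1 \<inter> e3 = {a}" "e2 \<inter> e3 = {c}"
    using E ends d by (auto simp: edge_Int_ends)
  obtain g1 where g1: "arc g1" "path_image g1 = e1" "pathstart g1 = a" "pathfinish g1 = b"
    by (rule edge_arc_between[OF E(1) ends(1) d(1)])
  obtain g2 where g2: "arc g2" "path_image g2 = e2" "pathstart g2 = b" "pathfinish g2 = c"
    by (rule edge_arc_between[OF E(2) ends(2) d(2)])
  obtain g3 where g3: "arc g3" "path_image g3 = e3" "pathstart g3 = c" "pathfinish g3 = a"
    by (rule edge_arc_between[OF E(3) ends(3) d(3)[symmetric]])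
  have j: "arc (g1 +++ g2)" by (rule arc_join) (use g1 g2 i in auto)
  have im: "path_image (g1 +++ g2) = e1 \<union> e2" using g1 g2 by (simp add: path_image_join)
  have "simple_path ((g1 +++ g2) +++ g3)"
    by (rule simple_path_join_loop[OF j g3(1)]) (use g1 g2 g3 i im in auto)
  moreover have "path_image ((g1 +++ g2) +++ g3) = e1 \<union> e2 \<union> e3"
    using g1 g2 g3 im by (simp add: path_image_join)
  ultimately show thesis using that[of "(g1 +++ g2) +++ g3"] g1 g3 by simp
qed

lemma triangle_boundary_curve:
  assumes F: "F \<in> faces V E" and b: "boundary F = {{a, b}, {b, c}, {c, a}}"
    and d: "a \<noteq> b" "b \<noteq> c" "a \<noteq> c"
  obtains p where "simple_path p" "pathfinish p = pathstart p" "path_image p = \<Union>(incident_edges E F)"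
proof -
  have "{a, b} \<in> ends V ` incident_edges E F" "{b, c} \<in> ends V ` incident_edges E F"
    "{c, a} \<in> ends V ` incident_edges E F" using b unfolding boundary_def by simp_all
  then obtain e1 e2 e3 where e: "e1 \<in> incident_edges E F" "e2 \<in> incident_edges E F" "e3 \<in> incident_edges E F"
    "ends V e1 = {a, b}" "ends V e2 = {b, c}" "ends V e3 = {c, a}" by (elim imageE) metis
  then have E: "e1 \<in> E" "e2 \<in> E" "e3 \<in> E" using incident_edges_subset[of F] by auto
  have "ends V ` incident_edges E F = ends V ` {e1, e2, e3}" using b e unfolding boundary_def by simp
  then have "incident_edges E F = {e1, e2, e3}"
    using inj_on_image_eq_iff[OF inj_ends incident_edges_subset, of "{e1, e2, e3}"] E by simp
  moreover obtain p where "simple_path p" "pathfinish p = pathstart p" "path_image p = e1 \<union> e2 \<union> e3"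
    by (rule triangle_curve[OF E e(4-6) d])
  ultimately show thesis using that[of p] by auto
qed

lemma triangle_other_face:
  assumes F: "F \<in> faces V E" and b: "boundary F = {{a, b}, {b, c}, {c, a}}"
    and d: "a \<noteq> b" "b \<noteq> c" "a \<noteq> c" and s: "s \<in> boundary F"
  obtains F' where "F' \<in> faces V E" "F' \<noteq> F" "s \<in> boundary F'"
proof -
  obtain p where p: "simple_path p" "pathfinish p = pathstart p" "path_image p = \<Union>(incident_edges E F)"
    by (rule triangle_boundary_curve[OF F b d])
  obtain e where e: "e \<in> incident_edges E F" "s = ends V e" using s unfolding boundary_def by auto
  then have eE: "e \<in> E" using incident_edges_subset by auto
  have "e \<subseteq> path_image p" using e p by auto
  moreover have "path_image p \<subseteq> drawing" unfolding p(3) drawing_def using incident_edges_subset by auto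
  ultimately obtain F' where "F' \<in> faces V E" "F' \<noteq> F" "e \<subseteq> frontier F'"
    by (rule closed_curve_other_face[OF eE p(1,2)])
  then show thesis using that[of F'] ends_in_boundary[OF eE] e(2) by auto
qed

text \<open>Both frontiers are the same Jordan curve, so each face contains one of its two sides. As
  the faces are disjoint, together they fill the complement of the curve, and nothing else is
  drawn.\<close>

lemma triangle_faces_same_boundary:
  assumes F: "F \<in> faces V E" "F' \<in> faces V E" "F \<noteq> F'" "boundary F' = boundary F"
    and b: "boundary F = {{a, b}, {b, c}, {c, a}}" and d: "a \<noteq> b" "b \<noteq> c" "a \<noteq> c"
  shows "boundary F = edge_ends"
proof -
  obtain p where p: "simple_path p" "pathfinish p = pathstart p" "path_image p = \<Union>(incident_edges E F)"
    by (rule triangle_boundary_curve[OF F(1) b d])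
  have same: "incident_edges E F' = incident_edges E F"
    using F(4) inj_on_image_eq_iff[OF inj_ends incident_edges_subset incident_edges_subset, of F' F]
    unfolding boundary_def by simp
  have fr: "frontier F = path_image p" "frontier F' = path_image p"
    using frontier_eq_Union_incident_edges[OF F(1) no_isolated] frontier_eq_Union_incident_edges[OF F(2) no_isolated]
      p(3) same by auto
  have J: "inside (path_image p) \<noteq> {}" "outside (path_image p) \<noteq> {}"
    "connected (inside (path_image p))" "connected (outside (path_image p))"
    "inside (path_image p) \<union> outside (path_image p) = - path_image p"
    using Jordan_inside_outside[OF p(1,2)] by auto
  have side: "inside (path_image p) \<subseteq> G \<or> outside (path_image p) \<subseteq> G"
    if G: "G \<in> faces V E" "frontier G = path_image p" for G
  proof -
    have "G \<inter> path_image p = {}" using face_disjoint[OF G(1)] face_frontier[OF G(1)] G(2) by blast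
    then have "inside (path_image p) \<inter> G \<noteq> {} \<or> outside (path_image p) \<inter> G \<noteq> {}"
      using face_nonempty[OF G(1)] J(5) by blast
    moreover have "inside (path_image p) \<inter> frontier G = {}" "outside (path_image p) \<inter> frontier G = {}"
      using J(5) G(2) by blast+
    ultimately show ?thesis using connected_subset_of_frontier_disjoint J(3,4) by metis
  qed
  have "F \<inter> F' = {}" by (rule faces_disjoint[OF F(1-3)])
  then have "- path_image p \<subseteq> F \<union> F'"
    using side[OF F(1) fr(1)] side[OF F(2) fr(2)] J(1,2,5) by blast
  then have "drawing \<subseteq> \<Union>(incident_edges E F)"
    using face_disjoint[OF F(1)] face_disjoint[OF F(2)] p(3) by auto
  then have "incident_edges E F = E" by (rule edges_eq_of_cover[OF incident_edges_subset])
  then show ?thesis unfolding boundary_def edge_ends_def by simp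
qed

section \<open>Vertex and face degrees\<close>


definition star :: "complex \<Rightarrow> complex set set" where
  "star v = {s \<in> edge_ends. v \<in> s}"

lemma special_iff:
  "special V E \<longleftrightarrow>
    (\<forall>v\<in>V. card (star v) \<ge> 3) \<and>
    (\<forall>F\<in>faces V E. card (boundary F) \<ge> 3) \<and>
    (\<forall>v\<in>V. \<forall>F\<in>faces V E. v \<in> \<Union>(boundary F) \<longrightarrow> card (star v) = 3 \<or> card (boundary F) = 3)"
  unfolding special_def star_def by (simp add: vertex_degree_eq face_degree_eq vertex_in_frontier)

lemma cubic_iff: "cubic V E \<longleftrightarrow> (\<forall>v\<in>V. card (star v) = 3)"
  unfolding cubic_def star_def by (simp add: vertex_degree_eq)

lemma sphere_triangulation_iff:
  "sphere_triangulation V E \<longleftrightarrow> (\<forall>F\<in>faces V E. card (boundary F) = 3) \<and> card edge_ends > 3"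
  unfolding sphere_triangulation_def by (simp add: face_degree_eq card_edge_ends)

lemma finite_star: "finite (star v)"
  unfolding star_def using finite_edge_ends by simp

lemma star_nonempty: "v \<in> V \<Longrightarrow> star v \<noteq> {}"
  using no_isolated[of v] mem_ends[of v] unfolding star_def edge_ends_def by auto

lemma triangle_card:
  "a \<noteq> b \<Longrightarrow> b \<noteq> c \<Longrightarrow> a \<noteq> c \<Longrightarrow> card {{a, b}, {b, c}, {c, a}} = 3"
  by (auto simp: card_insert_if doubleton_eq_iff)

text \<open>The vertex \<open>v\<close> supplies three edges of the graph, so a boundary with fewer
  edges is not the whole graph and would have to be a triangle.\<close>

lemma face_degree_ge_3:
  assumes F: "F \<in> faces V E" and v: "card (star v) \<ge> 3"
  shows "card (boundary F) \<ge> 3"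
proof (rule ccontr)
  assume less: "\<not> ?thesis"
  have "star v \<subseteq> edge_ends" unfolding star_def by auto
  then have "card (star v) \<le> card edge_ends" by (rule card_mono[OF finite_edge_ends])
  then have "boundary F \<noteq> edge_ends" using v less by auto
  then obtain a b c where "a \<noteq> b" "b \<noteq> c" "a \<noteq> c" "boundary F = {{a, b}, {b, c}, {c, a}}"
    using boundary_card_le_3_triangle[OF F] less by (metis linorder_not_le nat_less_le)
  then show False using less triangle_card[of a b c] by simp
qed

lemma cubic_imp_special: "cubic V E \<Longrightarrow> special V E"
  unfolding cubic_iff special_iff using face_degree_ge_3 V_ne by (metis all_not_in_conv order_refl)

text \<open>Writes the triangle so that it starts with a given edge. With more than three edges in
  the graph, a boundary of three edges is not everything and hence is cyclic.\<close>

lemma triangle_face_at: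
  assumes F: "F \<in> faces V E" "card (boundary F) = 3" and big: "card edge_ends > 3"
    and s: "{v, u} \<in> boundary F"
  obtains w where "v \<noteq> u" "u \<noteq> w" "v \<noteq> w" "boundary F = {{v, u}, {u, w}, {w, v}}"
proof -
  have vu: "v \<noteq> u" using s boundary_subset pair_edge_ends by blast
  have "boundary F \<noteq> edge_ends" using F(2) big by auto
  then obtain a b c where t: "a \<noteq> b" "b \<noteq> c" "a \<noteq> c" "boundary F = {{a, b}, {b, c}, {c, a}}"
    using boundary_card_le_3_triangle[OF F(1)] F(2) by (metis order_refl)
  then consider "v = a" "u = b" | "v = b" "u = a" | "v = b" "u = c" | "v = c" "u = b"
    | "v = c" "u = a" | "v = a" "u = c"
    using s by (auto simp: doubleton_eq_iff)
  then show thesis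
    by cases (use t that[of a] that[of b] that[of c] in \<open>simp_all add: insert_commute\<close>)
qed

lemma triangle_face_other:
  assumes F: "F \<in> faces V E" "card (boundary F) = 3" and big: "card edge_ends > 3"
    and s: "{v, u} \<in> boundary F"
  obtains F' where "F' \<in> faces V E" "F' \<noteq> F" "{v, u} \<in> boundary F'"
proof -
  obtain w where w: "v \<noteq> u" "u \<noteq> w" "v \<noteq> w" "boundary F = {{v, u}, {u, w}, {w, v}}"
    by (rule triangle_face_at[OF F big s])
  show thesis by (rule triangle_other_face[OF F(1) w(4,1-3) s]) (rule that)
qed

lemma triangle_face_unique:
  assumes F: "F \<in> faces V E" "F' \<in> faces V E" and big: "card edge_ends > 3"
    and b: "boundary F = {{a, b}, {b, c}, {c, a}}" "boundary F' = {{a, b}, {b, c}, {c, a}}"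
    and d: "a \<noteq> b" "b \<noteq> c" "a \<noteq> c"
  shows "F = F'"
proof (rule ccontr)
  assume "F \<noteq> F'"
  then have "boundary F = edge_ends"
    using triangle_faces_same_boundary[OF F _ _ b(1) d] b by auto
  then show False using big b(1) triangle_card[OF d] by simp
qed

text \<open>Only the vertex degrees need an argument. If \<open>v\<close> had just two edges, to
  \<open>u\<close> and \<open>w\<close>, then the triangles on both sides of the edge to
  \<open>u\<close> would have the same three edges and thus coincide.\<close>

lemma sphere_triangulation_imp_special:
  assumes "sphere_triangulation V E"
  shows "special V E"
proof -
  have tri: "\<And>F. F \<in> faces V E \<Longrightarrow> card (boundary F) = 3" and big: "card edge_ends > 3"
    using assms unfolding sphere_triangulation_iff by auto
  have "card (star v) \<ge> 3" if v: "v \<in> V" for v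
  proof (rule ccontr)
    assume less: "\<not> ?thesis"
    obtain s where "s \<in> star v" using star_nonempty[OF v] by auto
    then obtain u where "{v, u} \<in> edge_ends" using edge_ends_other[of s v] unfolding star_def by auto
    then obtain F where F: "F \<in> faces V E" "{v, u} \<in> boundary F" by (rule edge_ends_has_face)
    obtain w where w: "v \<noteq> u" "u \<noteq> w" "v \<noteq> w" "boundary F = {{v, u}, {u, w}, {w, v}}"
      by (rule triangle_face_at[OF F(1) tri[OF F(1)] big F(2)])
    have "{{v, u}, {w, v}} \<subseteq> star v" unfolding star_def using w(4) boundary_subset[of F] by auto
    moreover have "card {{v, u}, {w, v}} = 2" using w by (auto simp: doubleton_eq_iff)
    ultimately have star: "star v = {{v, u}, {w, v}}"
      using card_seteq[OF finite_star, of "{{v, u}, {w, v}}" v] less by auto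
    obtain F' where F': "F' \<in> faces V E" "F' \<noteq> F" "{v, u} \<in> boundary F'"
      by (rule triangle_face_other[OF F(1) tri[OF F(1)] big F(2)])
    obtain w' where w': "v \<noteq> u" "u \<noteq> w'" "v \<noteq> w'" "boundary F' = {{v, u}, {u, w'}, {w', v}}"
      by (rule triangle_face_at[OF F'(1) tri[OF F'(1)] big F'(3)])
    have "{w', v} \<in> star v" unfolding star_def using w'(4) boundary_subset[of F'] by auto
    then have "w' = w" using star w' by (auto simp: doubleton_eq_iff)
    then have "F' = F" using triangle_face_unique[OF F'(1) F(1) big] w w' by metis
    then show False using F'(2) by simp
  qed
  then show ?thesis unfolding special_iff using tri by simp
qed

text \<open>The only face that may fail to be a triangle is bounded by the rim, and it avoids the
  hub, the only vertex whose degree may differ from 3.\<close>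

lemma wheel_imp_special:
  assumes "wheel V E"
  shows "special V E"
proof -
  obtain n x and y :: "nat \<Rightarrow> complex" where n: "n \<ge> 3" and y: "inj_on y {..<n}" and x: "x \<notin> y ` {..<n}"
    and V: "V = insert x (y ` {..<n})"
    and ES: "edge_ends = (\<lambda>i. {y i, y (Suc i mod n)}) ` {..<n} \<union> (\<lambda>i. {x, y i}) ` {..<n}"
    and faces: "boundary ` faces V E = insert ((\<lambda>i. {y i, y (Suc i mod n)}) ` {..<n})
      ((\<lambda>i. {{y i, y (Suc i mod n)}, {x, y i}, {x, y (Suc i mod n)}}) ` {..<n})"
    using assms unfolding wheel_def Let_def edge_ends_def boundary_def by auto
  have y_eq: "y i = y j \<longleftrightarrow> i = j" if "i < n" "j < n" for i j
    using y that by (auto simp: inj_on_def)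
  have x_neq: "x \<noteq> y i" "y i \<noteq> x" if "i < n" for i using x that by auto
  \<comment> \<open>The last inequality needs \<open>n \<ge> 3\<close> and keeps rim edges distinct:
    two of them could coincide only if two steps along the rim led back to the start.\<close>
  have S: "Suc i mod n < n" "Suc i mod n \<noteq> i" "Suc (Suc i mod n) mod n \<noteq> i" if "i < n" for i
    using n that by (auto simp: mod_Suc)
  have rim_inj: "inj_on (\<lambda>i. {y i, y (Suc i mod n)}) {..<n}"
    by (rule inj_onI) (use S y_eq in \<open>auto simp: doubleton_eq_iff\<close>)
  have spoke_inj: "inj_on (\<lambda>i. {x, y i}) {..<n}"
    by (rule inj_onI) (use y_eq x_neq in \<open>auto simp: doubleton_eq_iff\<close>)
  have star_y: "card (star (y i)) = 3" if i: "i < n" for i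
  proof -
    define p where "p = (if i = 0 then n - 1 else i - 1)"
    have p: "p < n" "Suc p mod n = i" using i n unfolding p_def by auto
    have prev: "j = p" if "j < n" "Suc j mod n = i" for j
      using that i n unfolding p_def by (auto simp: mod_Suc split: if_splits)
    have "star (y i) = {{y i, y (Suc i mod n)}, {y p, y i}, {x, y i}}" (is "_ = ?T")
    proof
      show "star (y i) \<subseteq> ?T"
      proof
        fix s assume "s \<in> star (y i)"
        then have s: "s \<in> edge_ends" "y i \<in> s" unfolding star_def by auto
        then consider j where "j < n" "s = {y j, y (Suc j mod n)}" | j where "j < n" "s = {x, y j}"
          unfolding ES by auto
        then show "s \<in> ?T"
        proof cases
          case 1
          then have "i = j \<or> i = Suc j mod n" using s(2) y_eq i S(1) by auto
          then show ?thesis using 1 prev[of j] by auto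
        next
          case 2
          then show ?thesis using s(2) y_eq i x_neq by auto
        qed
      qed
      show "?T \<subseteq> star (y i)" unfolding star_def ES using i p by auto
    qed
    moreover have "p \<noteq> i" "p \<noteq> Suc i mod n" using p S[OF i] S[OF p(1)] by auto
    moreover have "card {{y i, y (Suc i mod n)}, {y p, y i}, {x, y i}} = 3"
      using calculation(2,3) y_eq[OF p(1) i] y_eq[OF p(1) S(1)[OF i]] x_neq[OF i] x_neq[OF p(1)]
        x_neq[OF S(1)[OF i]] y_eq[OF i S(1)[OF i]] S(2)[OF i]
      by (auto simp: card_insert_if doubleton_eq_iff)
    ultimately show ?thesis by simp
  qed
  have "star x = (\<lambda>i. {x, y i}) ` {..<n}"
    unfolding star_def ES using x_neq S(1) by auto
  then have star_x: "card (star x) = n" using card_image[OF spoke_inj] by simp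
  have bd: "boundary F = (\<lambda>i. {y i, y (Suc i mod n)}) ` {..<n} \<or> card (boundary F) = 3"
    if F: "F \<in> faces V E" for F
  proof -
    have "card {{y i, y (Suc i mod n)}, {x, y i}, {x, y (Suc i mod n)}} = 3" if "i < n" for i
      using triangle_card[of "y i" "y (Suc i mod n)" x] y_eq[OF that S(1)[OF that]] S(2)[OF that]
        x_neq[OF that] x_neq[OF S(1)[OF that]] by (simp add: insert_commute)
    moreover have "boundary F \<in> boundary ` faces V E" using F by simp
    ultimately show ?thesis unfolding faces by auto
  qed
  have rim_card: "card ((\<lambda>i. {y i, y (Suc i mod n)}) ` {..<n}) = n" using card_image[OF rim_inj] by simp
  show ?thesis unfolding special_iff
  proof (intro conjI ballI impI)
    fix v assume "v \<in> V"
    then show "3 \<le> card (star v)" using V star_x star_y n by auto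
  next
    fix F assume "F \<in> faces V E"
    then show "3 \<le> card (boundary F)" using bd[of F] rim_card n by auto
  next
    fix v F assume v: "v \<in> V" and F: "F \<in> faces V E" "v \<in> \<Union>(boundary F)"
    show "card (star v) = 3 \<or> card (boundary F) = 3"
    proof (cases "v = x")
      case True
      have "x \<notin> \<Union>((\<lambda>i. {y i, y (Suc i mod n)}) ` {..<n})" using x_neq S(1) by auto
      then have "boundary F \<noteq> (\<lambda>i. {y i, y (Suc i mod n)}) ` {..<n}" using F(2) True by metis
      then show ?thesis using bd[OF F(1)] by auto
    next
      case False
      then show ?thesis using v V star_y by auto
    qed
  qed
qed

end

section \<open>The cycle of neighbours of a good vertex\<close>

lemma eq_iff_mod_eq_of_period:
  fixes y :: "nat \<Rightarrow> 'a"
  assumes "n > 0" "\<And>i. y (i + n) = y i" "inj_on y {..<n}"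
  shows "y i = y j \<longleftrightarrow> i mod n = j mod n"
proof -
  have add: "y (i + k * n) = y i" for i k
  proof (induction k)
    case (Suc k)
    then show ?case using assms(2)[of "i + k * n"] by (simp add: algebra_simps)
  qed simp
  have "y i = y (i mod n)" for i
    using add[of "i mod n" "i div n"] by (simp add: mult.commute)
  moreover have "y (i mod n) = y (j mod n) \<longleftrightarrow> i mod n = j mod n"
    using assms(1,3) by (auto dest: inj_onD)
  ultimately show ?thesis by metis
qed

text \<open>The rim is treated as a periodic sequence on all natural numbers, which avoids
  \<open>mod\<close> in most arguments; this lemma leads back to the finite index set in
  \<open>wheel\<close>.\<close>

lemma image_eq_range_of_mod_eq:
  fixes f :: "nat \<Rightarrow> 'a"
  assumes "n > 0" "\<And>i. f (i mod n) = f i"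
  shows "f ` {..<n} = range f"
proof -
  have "f i \<in> f ` {..<n}" for i using assms by (metis image_eqI lessThan_iff mod_less_divisor)
  then show ?thesis by auto
qed

context simple_plane
begin

definition good :: "complex \<Rightarrow> bool" where
  "good v \<longleftrightarrow> (\<forall>F\<in>faces V E. v \<in> \<Union>(boundary F) \<longrightarrow> card (boundary F) = 3)"

lemma goodD: "good v \<Longrightarrow> F \<in> faces V E \<Longrightarrow> s \<in> boundary F \<Longrightarrow> v \<in> s \<Longrightarrow> card (boundary F) = 3"
  unfolding good_def by blast

text \<open>A walk around \<open>x\<close>: cross the triangle \<open>F i\<close> from the spoke at
  \<open>y i\<close> to its other spoke, then enter the other face there. The condition
  \<open>F (Suc i) \<noteq> F i\<close> prevents turning back.\<close>

lemma link_sequence: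
  assumes big: "card edge_ends > 3" and x: "good x" and y0: "{x, y0} \<in> edge_ends"
  obtains y F where "y (0::nat) = y0" "\<And>i. F i \<in> faces V E" "\<And>i. x \<noteq> y i" "\<And>i. y i \<noteq> y (Suc i)"
    "\<And>i. boundary (F i) = {{x, y i}, {y i, y (Suc i)}, {y (Suc i), x}}" "\<And>i. F (Suc i) \<noteq> F i"
proof -
  \<comment> \<open>The state of the walk is a neighbour of \<open>x\<close> with a face at its
    spoke: \<open>P\<close> is the invariant of a state, \<open>Q\<close> the step to the
    next.\<close>
  define P where "P n p \<longleftrightarrow> (n = (0::nat) \<longrightarrow> fst p = y0) \<and> snd p \<in> faces V E \<and> {x, fst p} \<in> boundary (snd p)"
    for n p
  define Q where "Q p q \<longleftrightarrow> x \<noteq> fst p \<and> fst p \<noteq> fst q \<and>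
      boundary (snd p) = {{x, fst p}, {fst p, fst q}, {fst q, x}} \<and> snd q \<noteq> snd p" for p q
  have "\<exists>f. \<forall>n. P n (f n) \<and> Q (f n) (f (Suc n))"
  proof (rule dependent_nat_choice)
    obtain F where "F \<in> faces V E" "{x, y0} \<in> boundary F" by (rule edge_ends_has_face[OF y0])
    then show "\<exists>p. P 0 p" unfolding P_def by (intro exI[of _ "(y0, F)"]) simp
  next
    fix p n assume "P n p"
    then have p: "snd p \<in> faces V E" "{x, fst p} \<in> boundary (snd p)" unfolding P_def by auto
    have c: "card (boundary (snd p)) = 3" by (rule goodD[OF x p]) simp
    obtain w where w: "x \<noteq> fst p" "fst p \<noteq> w" "x \<noteq> w" "boundary (snd p) = {{x, fst p}, {fst p, w}, {w, x}}"
      by (rule triangle_face_at[OF p(1) c big p(2)])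
    then have "{x, w} \<in> boundary (snd p)" by (auto simp: insert_commute)
    then obtain F' where "F' \<in> faces V E" "F' \<noteq> snd p" "{x, w} \<in> boundary F'"
      by (rule triangle_face_other[OF p(1) c big])
    then show "\<exists>q. P (Suc n) q \<and> Q p q"
      using w unfolding P_def Q_def by (intro exI[of _ "(w, F')"]) simp
  qed
  then obtain f where f: "\<And>n. P n (f n)" "\<And>n. Q (f n) (f (Suc n))" by auto
  show thesis
    by (rule that[of "\<lambda>i. fst (f i)" "\<lambda>i. snd (f i)"]) (use f in \<open>auto simp: P_def Q_def\<close>)
qed

text \<open>There are finitely many vertices, so the walk repeats one. Since a spoke has at most two
  faces, the first repetition must be a return to the start, and the walk is periodic from
  there.\<close>

lemma link_cycle:
  assumes big: "card edge_ends > 3" and x: "good x" "x \<in> V" and y0: "{x, y0} \<in> edge_ends"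
  obtains n y F where "n \<ge> 3" "y (0::nat) = y0"
    "\<forall>i. F i \<in> faces V E" "\<forall>i. x \<noteq> y i"
    "\<forall>i. boundary (F i) = {{x, y i}, {y i, y (Suc i)}, {y (Suc i), x}}" "\<forall>i. F (Suc i) \<noteq> F i"
    "\<forall>i. F (i + n) = F i" "\<forall>i j. y i = y j \<longleftrightarrow> i mod n = j mod n"
    "star x = range (\<lambda>i. {x, y i})"
proof -
  obtain y F where y0': "y (0::nat) = y0" and F: "\<And>i. F i \<in> faces V E" and xy: "\<And>i. x \<noteq> y i"
    and yy: "\<And>i. y i \<noteq> y (Suc i)"
    and B: "\<And>i. boundary (F i) = {{x, y i}, {y i, y (Suc i)}, {y (Suc i), x}}"
    and FF: "\<And>i. F (Suc i) \<noteq> F i"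
    using link_sequence[OF big x(1) y0] by metis
  have spoke: "{x, v} \<in> boundary (F i) \<longleftrightarrow> v = y i \<or> v = y (Suc i)" for v i
    unfolding B using xy[of i] xy[of "Suc i"] by (auto simp: doubleton_eq_iff)
  have two: "G = F i \<or> G = F (Suc i)" if "G \<in> faces V E" "{x, y (Suc i)} \<in> boundary G" for G i
    using at_most_two_faces[OF that(1) F F that(2), of i "Suc i"] spoke FF by metis
  have "y i \<in> V" for i
    using spoke[of "y i" i] boundary_subset[of "F i"] pair_edge_ends[of x "y i"] by blast
  then have "finite (range y)" by (meson finite_V finite_subset image_subsetI)
  then have "\<not> inj y" using finite_imageD by blast
  then obtain a b where "a \<noteq> b" "y a = y b" unfolding inj_def by blast
  then have ex: "\<exists>j. \<exists>i<j. y i = y j" by (metis nat_neq_iff)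
  define m where "m = (LEAST j. \<exists>i<j. y i = y j)"
  obtain i where i: "i < m" "y i = y m" using LeastI_ex[OF ex] unfolding m_def by blast
  have min: "y k \<noteq> y j" if "k < j" "j < m" for k j
    using not_less_Least[of j "\<lambda>j. \<exists>i<j. y i = y j"] that unfolding m_def by blast
  obtain m' where m': "m = Suc m'" using i by (cases m) auto
  \<comment> \<open>Otherwise the walk would come back to \<open>y i\<close> through the face by
    which it left, which forces \<open>m' = Suc i\<close> and hence two equal consecutive
    faces.\<close>
  have Fm': "F m' \<noteq> F i"
  proof
    assume eq: "F m' = F i"
    have im: "i \<noteq> m'" using yy[of m'] i m' by auto
    then have "y m' \<noteq> y i" using min[of i m'] i m' by auto
    then have "y m' = y (Suc i)" using spoke[of "y m'" m'] spoke[of "y m'" i] eq by auto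
    then have "m' = Suc i" using min[of "Suc i" m'] im i m' by (metis Suc_lessI lessI less_antisym)
    then show False using FF[of i] eq by simp
  qed
  \<comment> \<open>For \<open>i = Suc k\<close> the faces at this spoke are \<open>F k\<close> and
    \<open>F i\<close>, so \<open>F m'\<close> is \<open>F k\<close>. Then \<open>y m'\<close> is
    \<open>y k\<close> or \<open>y i\<close>; minimality of \<open>m\<close> excludes the first, and
    \<open>y m' \<noteq> y m\<close> the second.\<close>
  have "i = 0"
  proof (rule ccontr)
    assume "i \<noteq> 0"
    then obtain k where k: "i = Suc k" by (cases i) auto
    have "{x, y (Suc k)} \<in> boundary (F m')" using spoke[of "y m" m'] i m' k by auto
    then have eq: "F m' = F k" using two[OF F] Fm' k by metis
    have "y m' \<noteq> y k" using min[of k m'] i m' k by auto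
    then have "y m' = y (Suc k)" using spoke[of "y m'" m'] spoke[of "y m'" k] eq by auto
    then show False using yy[of m'] i m' k by simp
  qed
  then have ym: "y m = y 0" using i by simp
  have "F m = F 0"
    using at_most_two_faces[OF F F F, of "{x, y 0}" m' m 0] spoke[of "y 0"] ym m' FF[of m'] Fm' \<open>i = 0\<close>
    by auto
  have per: "y (j + m) = y j \<and> F (j + m) = F j" for j
  proof (induction j)
    case 0
    then show ?case using ym \<open>F m = F 0\<close> by simp
  next
    case (Suc j)
    have "y (Suc j + m) \<noteq> y j" using yy[of "j + m"] Suc by simp
    then have 1: "y (Suc j + m) = y (Suc j)"
      using spoke[of "y (Suc j + m)" "j + m"] spoke[of "y (Suc j + m)" j] Suc by simp
    then have "F (Suc j + m) = F j \<or> F (Suc j + m) = F (Suc j)"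
      using two[OF F, of j "Suc j + m"] spoke[of "y (Suc j)" "Suc j + m"] by simp
    then show ?case using 1 FF[of "j + m"] Suc by auto
  qed
  have "m \<noteq> 1" using yy[of 0] ym by auto
  \<comment> \<open>After two steps \<open>F 0\<close> and \<open>F (Suc 0)\<close> would be
    different faces bounded by the same triangle.\<close>
  moreover have "m \<noteq> 2"
  proof
    assume "m = 2"
    then have "y (Suc (Suc 0)) = y 0" using ym by (simp add: numeral_2_eq_2)
    then have "boundary (F (Suc 0)) = {{x, y 0}, {y 0, y (Suc 0)}, {y (Suc 0), x}}"
      using B[of "Suc 0"] by (simp add: insert_commute)
    then have "F (Suc 0) = F 0"
      using triangle_face_unique[OF F F big _ B, of "Suc 0" 0] xy yy by auto
    then show False using FF by blast
  qed
  ultimately have m3: "m \<ge> 3" using i by auto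
  have "inj_on y {..<m}"
    by (rule linorder_inj_onI) (use min in auto)
  then have y_eq: "y i = y j \<longleftrightarrow> i mod m = j mod m" for i j
    using eq_iff_mod_eq_of_period[of m y] per m3 by auto
  \<comment> \<open>Shifting by a full period gives index 0 a predecessor too.\<close>
  have pred: "\<exists>k. y j = y (Suc k) \<and> F j = F (Suc k)" for j
    using per[of j] m3 by (intro exI[of _ "j + m - 1"]) auto
  have spoke_edge: "{x, y i} \<in> edge_ends" for i
    using subsetD[OF boundary_subset[of "F i"], of "{x, y i}"] spoke[of "y i" i] by simp
  have star_eq: "star x = range (\<lambda>i. {x, y i})"
    unfolding star_def
  \<comment> \<open>Every face at a visited spoke is some \<open>F l\<close>, whose two edges at
    \<open>x\<close> are visited as well. So the visited spokes are closed under sharing a face, and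
    the connected link leaves no others.\<close>
  proof (rule link_connected_ends[OF x(2), symmetric])
    show "range (\<lambda>i. {x, y i}) \<noteq> {}" by simp
    show "range (\<lambda>i. {x, y i}) \<subseteq> {s \<in> edge_ends. x \<in> s}"
      using spoke_edge by auto
    show "\<exists>F1\<in>faces V E. \<exists>F2\<in>faces V E. F1 \<noteq> F2 \<and> s \<in> boundary F1 \<and> s \<in> boundary F2"
      if s: "s \<in> range (\<lambda>i. {x, y i})" for s
    proof -
      obtain j where "s = {x, y j}" using s by auto
      moreover obtain k where "y j = y (Suc k)" using pred[of j] by auto
      ultimately have "s \<in> boundary (F k)" "s \<in> boundary (F (Suc k))"
        using spoke[of "y (Suc k)"] by auto
      then show ?thesis using F FF[of k] by blast
    qed
    show "t \<in> range (\<lambda>i. {x, y i})"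
      if G: "G \<in> faces V E" "s \<in> range (\<lambda>i. {x, y i})" "s \<in> boundary G" "t \<in> boundary G" "x \<in> t" for G s t
    proof -
      obtain j where "s = {x, y j}" using G(2) by auto
      moreover obtain k where "y j = y (Suc k)" using pred[of j] by auto
      ultimately have "G = F k \<or> G = F (Suc k)" using two[OF G(1), of k] G(3) by simp
      then obtain l where "t \<in> boundary (F l)" using G(4) by auto
      then have "t = {x, y l} \<or> t = {x, y (Suc l)}" using G(5) B[of l] xy[of l] xy[of "Suc l"] by auto
      then show ?thesis by auto
    qed
  qed
  show thesis
    by (rule that[of m y F, OF m3 y0' _ _ _ _ _ _ star_eq]) (simp_all add: F xy B FF per y_eq)
qed

text \<open>A rim vertex has only two rim edges, so minimum degree two carries membership in
  \<open>H\<close> from one rim edge to the next, all the way round.\<close>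

lemma rim_cyclic_subset:
  fixes y :: "nat \<Rightarrow> complex"
  assumes H: "H \<subseteq> range (\<lambda>i. {y i, y (Suc i)})" "H \<noteq> {}" "\<forall>s\<in>H. \<forall>v\<in>s. \<exists>t\<in>H - {s}. v \<in> t"
    and n: "n \<ge> 3" and y_eq: "\<And>i j. y i = y j \<longleftrightarrow> i mod n = j mod n"
  shows "H = range (\<lambda>i. {y i, y (Suc i)})"
proof -
  have suc: "y (Suc i) = y (Suc j) \<longleftrightarrow> y i = y j" for i j
    unfolding y_eq using n by (auto simp: mod_Suc split: if_splits)
  have step: "{y (Suc i), y (Suc (Suc i))} \<in> H" if i: "{y i, y (Suc i)} \<in> H" for i
  proof -
    obtain t where t: "t \<in> H" "t \<noteq> {y i, y (Suc i)}" "y (Suc i) \<in> t" using bspec[OF bspec[OF H(3) i], of "y (Suc i)"] by auto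
    then obtain j where j: "t = {y j, y (Suc j)}" using H(1) by auto
    have "y (Suc i) \<noteq> y (Suc j)"
    proof
      assume "y (Suc i) = y (Suc j)"
      then show False using suc[of i j] t(2) j by simp
    qed
    then have "y j = y (Suc i)" using t(3) j by auto
    then show ?thesis using t(1) j suc[of j "Suc i"] by simp
  qed
  obtain i0 where i0: "{y i0, y (Suc i0)} \<in> H" using H(1,2) by auto
  have ge: "{y (i0 + k), y (Suc (i0 + k))} \<in> H" for k
    by (induction k) (use i0 step in auto)
  have "{y i, y (Suc i)} \<in> H" for i
  proof -
    \<comment> \<open>The number of steps is chosen to lead from \<open>i0\<close> to
      \<open>i + i0 * n\<close>, which is at least \<open>i0\<close> and represents the same rim
      vertex as \<open>i\<close>.\<close>
    have "i0 + (i + i0 * n - i0) = i + i0 * n" using n by (cases n) auto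
    then have "y (i0 + (i + i0 * n - i0)) = y i" unfolding y_eq by simp
    then show ?thesis using ge[of "i + i0 * n - i0"] suc[of "i0 + (i + i0 * n - i0)" i] by simp
  qed
  then show ?thesis using H(1) by auto
qed


section \<open>Recognising the wheel\<close>

lemma connected_graph_closed:
  assumes "connected_graph V E" "x \<in> V" "x \<in> W"
    and W: "\<And>u v. u \<in> W \<Longrightarrow> {u, v} \<in> edge_ends \<Longrightarrow> v \<in> W"
  shows "V \<subseteq> W"
proof
  fix v assume "v \<in> V"
  then have "(adjacent V E)\<^sup>*\<^sup>* x v" using assms(1,2) unfolding connected_graph_def by blast
  then show "v \<in> W"
  proof (induction rule: rtranclp_induct)
    case base
    then show ?case using assms(3) .
  next
    case (step u v)
    then have "{u, v} \<in> edge_ends" unfolding adjacent_def edge_ends_def by auto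
    then show ?case using W step.IH by blast
  qed
qed

text \<open>The prescribed stars are closed under adjacency, so connectedness leaves no further
  vertices or edges. A face with a spoke is some \<open>F j\<close>; a face without spokes has a
  cyclic part inside the rim, hence the whole rim as boundary. \<open>G0\<close> shows that such a
  face exists.\<close>

lemma wheel_of_cubic_link:
  assumes conn: "connected_graph V E" and xV: "x \<in> V"
    and n: "n \<ge> 3" and F: "\<And>i. F i \<in> faces V E" and xy: "\<And>i. x \<noteq> y i"
    and B: "\<And>i. boundary (F i) = {{x, y i}, {y i, y (Suc i)}, {y (Suc i), x}}"
    and spoke_face: "\<And>G i. G \<in> faces V E \<Longrightarrow> {x, y i} \<in> boundary G \<Longrightarrow> \<exists>j. G = F j"
    and y_eq: "\<And>i j. y i = y j \<longleftrightarrow> i mod n = j mod n"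
    and star_x: "star x = range (\<lambda>i. {x, y i})"
    and star_y: "\<And>i. star (y (Suc i)) = {{x, y (Suc i)}, {y i, y (Suc i)}, {y (Suc i), y (Suc (Suc i))}}"
    and G0: "G0 \<in> faces V E" "\<And>i. {x, y i} \<notin> boundary G0"
  shows "wheel V E"
proof -
  let ?rim = "\<lambda>i. {y i, y (Suc i)}"
  have n0: "n > 0" using n by simp
  have y_mod: "y (i mod n) = y i" "y (Suc (i mod n)) = y (Suc i)" "y (Suc i mod n) = y (Suc i)" for i
    unfolding y_eq by (simp_all add: mod_Suc_eq)
  have pred: "\<exists>k. y i = y (Suc k)" for i
    using n unfolding y_eq by (intro exI[of _ "i + n - 1"]) simp
  have starD: "s \<in> range ?rim \<or> s \<in> range (\<lambda>i. {x, y i})"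
    if s: "s \<in> star u" and u: "u \<in> insert x (range y)" for s u
  proof (cases "u = x")
    case True
    then show ?thesis using s star_x by auto
  next
    case False
    then obtain i where "u = y i" using u by auto
    moreover obtain k where "y i = y (Suc k)" using pred by blast
    ultimately show ?thesis using s star_y[of k] by auto
  qed
  have V: "V = insert x (range y)"
  proof
    show "V \<subseteq> insert x (range y)"
    proof (rule connected_graph_closed[OF conn xV])
      fix u v assume u: "u \<in> insert x (range y)" and uv: "{u, v} \<in> edge_ends"
      then have "{u, v} \<in> star u" unfolding star_def by simp
      then have "{u, v} \<in> range ?rim \<or> {u, v} \<in> range (\<lambda>i. {x, y i})"
        using u starD by blast
      then show "v \<in> insert x (range y)" by (auto simp: doubleton_eq_iff)
    qed simp
    have "star (y i) \<noteq> {}" for i using star_y pred[of i] by auto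
    then have "y i \<in> V" for i unfolding star_def using edge_ends_subset by blast
    then show "insert x (range y) \<subseteq> V" using xV by auto
  qed
  have ES: "edge_ends = range ?rim \<union> range (\<lambda>i. {x, y i})"
  proof
    show "edge_ends \<subseteq> range ?rim \<union> range (\<lambda>i. {x, y i})"
    proof
      fix s assume s: "s \<in> edge_ends"
      then obtain a b where "a \<in> V" "s = {a, b}" using edge_ends_doubleton by metis
      then have "s \<in> star a" "a \<in> insert x (range y)" using s V unfolding star_def by auto
      then show "s \<in> range ?rim \<union> range (\<lambda>i. {x, y i})" using starD by blast
    qed
    have "?rim i \<in> edge_ends" "{x, y i} \<in> edge_ends" for i
      using subsetD[OF boundary_subset[of "F i"]] B[of i] by simp_all
    then show "range ?rim \<union> range (\<lambda>i. {x, y i}) \<subseteq> edge_ends" by auto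
  qed
  have no_spoke: "boundary G = range ?rim" if G: "G \<in> faces V E" "\<And>i. {x, y i} \<notin> boundary G" for G
  proof -
    have sub: "boundary G \<subseteq> range ?rim" using boundary_subset[of G] G(2) ES by auto
    have "{x, y 0} \<in> edge_ends" using ES by auto
    then have "boundary G \<noteq> edge_ends" using G(2) by auto
    then obtain H where H: "H \<subseteq> boundary G" "H \<noteq> {}" "\<forall>s\<in>H. \<forall>v\<in>s. \<exists>t\<in>H - {s}. v \<in> t"
      by (rule boundary_cyclic[OF G(1)])
    have "H \<subseteq> range ?rim" using H(1) sub by (rule order_trans)
    then have "H = range ?rim" by (rule rim_cyclic_subset[OF _ H(2,3) n y_eq])
    then show ?thesis using H(1) sub by auto
  qed
  have faces: "boundary ` faces V E = insert (range ?rim) (range (\<lambda>i. {?rim i, {x, y i}, {x, y (Suc i)}}))"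
  proof
    show "boundary ` faces V E \<subseteq> insert (range ?rim) (range (\<lambda>i. {?rim i, {x, y i}, {x, y (Suc i)}}))"
    proof
      fix b assume "b \<in> boundary ` faces V E"
      then obtain G where G: "G \<in> faces V E" "b = boundary G" by auto
      show "b \<in> insert (range ?rim) (range (\<lambda>i. {?rim i, {x, y i}, {x, y (Suc i)}}))"
      proof (cases "\<exists>i. {x, y i} \<in> boundary G")
        case True
        then obtain j where "G = F j" using spoke_face[OF G(1)] by blast
        then have "b = {?rim j, {x, y j}, {x, y (Suc j)}}" using G(2) B[of j] by (simp add: insert_commute)
        then show ?thesis by auto
      next
        case False
        then show ?thesis using no_spoke[OF G(1)] G(2) by auto
      qed
    qed
    have "{?rim i, {x, y i}, {x, y (Suc i)}} = boundary (F i)" for i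
      using B[of i] by (simp add: insert_commute)
    moreover have "range ?rim = boundary G0" using no_spoke[OF G0] by simp
    ultimately show "insert (range ?rim) (range (\<lambda>i. {?rim i, {x, y i}, {x, y (Suc i)}})) \<subseteq> boundary ` faces V E"
      using F G0(1) by auto
  qed
  have range: "y ` {..<n} = range y" "?rim ` {..<n} = range ?rim" "(\<lambda>i. {x, y i}) ` {..<n} = range (\<lambda>i. {x, y i})"
    "(\<lambda>i. {?rim i, {x, y i}, {x, y (Suc i)}}) ` {..<n} = range (\<lambda>i. {?rim i, {x, y i}, {x, y (Suc i)}})"
    by (rule image_eq_range_of_mod_eq[OF n0]; simp only: y_mod)+
  show ?thesis
    unfolding wheel_def Let_def boundary_def[symmetric] edge_ends_def[symmetric]
  proof (intro exI[of _ n] exI[of _ x] exI[of _ y] conjI)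
    show "inj_on y {..<n}" using y_eq by (auto simp: inj_on_def)
    show "x \<notin> y ` {..<n}" using xy by auto
    show "V = insert x (y ` {..<n})" using V range(1) by simp
    show "edge_ends = (\<lambda>i. {y i, y (Suc i mod n)}) ` {..<n} \<union> (\<lambda>i. {x, y i}) ` {..<n}"
      unfolding y_mod using ES range(2,3) by simp
    show "boundary ` faces V E = insert ((\<lambda>i. {y i, y (Suc i mod n)}) ` {..<n})
      ((\<lambda>i. {{y i, y (Suc i mod n)}, {x, y i}, {x, y (Suc i mod n)}}) ` {..<n})"
      unfolding y_mod using faces range(2,4) by simp
  qed (rule n)
qed

lemma good_neighbour_not_good_imp_wheel:
  assumes conn: "connected_graph V E" and sp: "special V E"
    and x: "x \<in> V" "good x" and y0: "{x, y0} \<in> edge_ends" "\<not> good y0"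
  shows "wheel V E"
proof -
  have deg3: "\<And>v. v \<in> V \<Longrightarrow> card (star v) \<ge> 3"
    and inc: "\<And>v G. v \<in> V \<Longrightarrow> G \<in> faces V E \<Longrightarrow> v \<in> \<Union>(boundary G) \<Longrightarrow> card (star v) = 3 \<or> card (boundary G) = 3"
    using sp unfolding special_iff by blast+
  \<comment> \<open>With at most three edges every vertex would lie on all of them, leaving only the
    edge between \<open>x\<close> and \<open>y0\<close> and so degree 1 at \<open>x\<close>.\<close>
  have big: "card edge_ends > 3"
  proof (rule ccontr)
    assume le: "\<not> card edge_ends > 3"
    have "v \<in> \<Inter>edge_ends" if "v \<in> V" for v
    proof -
      have "star v \<subseteq> edge_ends" unfolding star_def by auto
      then have "star v = edge_ends"
        using deg3[OF that] le by (intro card_seteq[OF finite_edge_ends]) auto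
      then show ?thesis unfolding star_def by auto
    qed
    then have "V \<subseteq> {x, y0}" using y0(1) by blast
    have "s = {x, y0}" if s: "s \<in> edge_ends" for s
    proof -
      obtain a b where "a \<noteq> b" "a \<in> V" "b \<in> V" "s = {a, b}" by (rule edge_ends_doubleton[OF s])
      then show ?thesis using \<open>V \<subseteq> {x, y0}\<close> by auto
    qed
    then have "star x \<subseteq> {{x, y0}}" unfolding star_def by auto
    then have "card (star x) \<le> 1" using card_mono[of "{{x, y0}}"] by auto
    then show False using deg3[OF x(1)] by simp
  qed
  obtain n y F where n: "n \<ge> 3" and y0': "y (0::nat) = y0" and link: "\<forall>i. F i \<in> faces V E"
    "\<forall>i. x \<noteq> y i" "\<forall>i. boundary (F i) = {{x, y i}, {y i, y (Suc i)}, {y (Suc i), x}}"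
    "\<forall>i. F (Suc i) \<noteq> F i" "\<forall>i. F (i + n) = F i" "\<forall>i j. y i = y j \<longleftrightarrow> i mod n = j mod n"
    and star_x: "star x = range (\<lambda>i. {x, y i})"
    by (rule link_cycle[OF big x(2,1) y0(1)])
  note F = link(1)[rule_format] and xy = link(2)[rule_format] and B = link(3)[rule_format]
    and FF = link(4)[rule_format] and Fn = link(5)[rule_format] and y_eq = link(6)[rule_format]
  have yn: "y (i + n) = y i" for i unfolding y_eq by simp
  have pred: "\<exists>k. y i = y (Suc k) \<and> F i = F (Suc k)" for i
    using yn[of i] Fn[of i] n by (intro exI[of _ "i + n - 1"]) auto
  have y_neq: "y i \<noteq> y (Suc i)" "y i \<noteq> y (Suc (Suc i))" for i
    unfolding y_eq using n by (auto simp: mod_Suc split: if_splits)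
  have cardF: "card (boundary (F i)) = 3" for i
    using B[of i] triangle_card[of x "y i" "y (Suc i)"] xy y_neq by simp
  have yV: "y i \<in> V" for i
    using edge_ends_subset[OF subsetD[OF boundary_subset[of "F i"], of "{x, y i}"]] B[of i] by auto
  have rim_F: "{y (Suc i), y (Suc (Suc i))} \<notin> boundary (F i)" for i
    unfolding B using y_neq[of i] y_neq[of "Suc i"] xy by (auto simp: doubleton_eq_iff)
  have spoke_face: "G = F i \<or> G = F (Suc i)"
    if "G \<in> faces V E" "{x, y (Suc i)} \<in> boundary G" for G i
    using at_most_two_faces[OF that(1) F[of i] F[of "Suc i"] that(2)] FF[of i] B[of i] B[of "Suc i"]
    by (auto simp: insert_commute)
  have star_y: "star (y (Suc i)) = {{x, y (Suc i)}, {y i, y (Suc i)}, {y (Suc i), y (Suc (Suc i))}}" (is "_ = ?T")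
    if ng: "\<not> good (y (Suc i))" for i
  proof -
    have "?T \<subseteq> star (y (Suc i))"
      using subsetD[OF boundary_subset[of "F i"]] subsetD[OF boundary_subset[of "F (Suc i)"]] B[of i] B[of "Suc i"]
      unfolding star_def by auto
    moreover have "card ?T = 3"
      using y_neq[of i] y_neq[of "Suc i"] xy by (auto simp: card_insert_if doubleton_eq_iff)
    moreover have "card (star (y (Suc i))) = 3" using inc[OF yV] ng unfolding good_def by blast
    ultimately show ?thesis using card_seteq[OF finite_star, of ?T "y (Suc i)"] by simp
  qed
  \<comment> \<open>If \<open>?w\<close> were good, the face \<open>Q\<close> beyond the rim edge
    from \<open>?u\<close> to \<open>?w\<close> would be a triangle. As \<open>?u\<close> has only
    three edges, the third vertex of \<open>Q\<close> is \<open>x\<close> or \<open>?p\<close>, and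
    \<open>x\<close> is excluded because \<open>Q\<close> is neither of the two faces at that spoke.
    Hence \<open>Q\<close> also borders the edge from \<open>?p\<close> to
    \<open>?u\<close>.\<close>
  have not_good_step: "\<not> good (y (Suc (Suc i)))" if ng: "\<not> good (y (Suc i))" for i
  proof
    assume gw: "good (y (Suc (Suc i)))"
    let ?p = "y i" and ?u = "y (Suc i)" and ?w = "y (Suc (Suc i))"
    have uw: "{?u, ?w} \<in> boundary (F (Suc i))" using B by simp
    obtain Q where Q: "Q \<in> faces V E" "Q \<noteq> F (Suc i)" "{?u, ?w} \<in> boundary Q"
      by (rule triangle_face_other[OF F cardF big uw])
    have cQ: "card (boundary Q) = 3" by (rule goodD[OF gw Q(1,3)]) simp
    have Qi: "Q \<noteq> F i" using Q(3) rim_F by metis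
    obtain z where z: "?u \<noteq> ?w" "?w \<noteq> z" "?u \<noteq> z" "boundary Q = {{?u, ?w}, {?w, z}, {z, ?u}}"
      by (rule triangle_face_at[OF Q(1) cQ big Q(3)])
    have "{z, ?u} \<in> star ?u" unfolding star_def using z(4) boundary_subset[of Q] by auto
    then have "z = x \<or> z = ?p" using star_y[OF ng] z(1-3) by (auto simp: doubleton_eq_iff)
    moreover have "z \<noteq> x" using spoke_face[OF Q(1), of i] Qi Q(2) z(4) by auto
    ultimately have pQ: "{?p, ?u} \<in> boundary Q" using z(4) by auto
    obtain G where G: "G \<in> faces V E" "?u \<in> \<Union>(boundary G)" "card (boundary G) \<noteq> 3"
      using ng unfolding good_def by blast
    obtain s where s: "s \<in> boundary G" "?u \<in> s" using G(2) by auto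
    then have "s \<in> star ?u" unfolding star_def using boundary_subset[of G] by auto
    \<comment> \<open>The face \<open>G\<close> that is not a triangle uses one of the three edges
      at \<open>?u\<close>. The spoke has only triangular faces since \<open>x\<close> is good, and
      each rim edge already has two triangles: \<open>Q\<close> and one of the
      \<open>F\<close>.\<close>
    then consider "s = {x, ?u}" | "s = {?p, ?u}" | "s = {?u, ?w}" using star_y[OF ng] by auto
    then show False
    proof cases
      case 1
      then show ?thesis using goodD[OF x(2) G(1) s(1)] G(3) by simp
    next
      case 2
      have "{?p, ?u} \<in> boundary (F i)" using B by simp
      then have "Q = F i \<or> Q = G \<or> F i = G"
        using at_most_two_faces[OF Q(1) F G(1) pQ] s(1) 2 by auto
      then show ?thesis using Qi cQ cardF[of i] G(3) by auto
    next
      case 3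
      then have "Q = F (Suc i) \<or> Q = G \<or> F (Suc i) = G"
        using at_most_two_faces[OF Q(1) F G(1) Q(3) uw] s(1) by auto
      then show ?thesis using Q(2) cQ cardF[of "Suc i"] G(3) by auto
    qed
  qed
  have ng: "\<not> good (y i)" for i
  proof (induction i)
    case 0
    then show ?case using y0(2) y0' by simp
  next
    case (Suc i)
    obtain k where k: "y i = y (Suc k)" using pred by blast
    then have "y (Suc i) = y (Suc (Suc k))" unfolding y_eq by (simp add: mod_Suc)
    then show ?case using not_good_step[of k] Suc k by simp
  qed
  obtain G0 where G0: "G0 \<in> faces V E" "card (boundary G0) \<noteq> 3"
    using y0(2) unfolding good_def by blast
  have "{x, y i} \<notin> boundary G0" for i using goodD[OF x(2) G0(1), of "{x, y i}"] G0(2) by auto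
  moreover have "\<exists>j. G = F j" if "G \<in> faces V E" "{x, y i} \<in> boundary G" for G i
    using spoke_face[OF that(1)] that(2) pred[of i] by metis
  ultimately show ?thesis
    using wheel_of_cubic_link[OF conn x(1) n F xy B _ y_eq star_x star_y[OF ng] G0(1)] by blast
qed

lemma special_imp:
  assumes conn: "connected_graph V E" and sp: "special V E"
  shows "cubic V E \<or> sphere_triangulation V E \<or> wheel V E"
proof (cases "\<exists>x\<in>V. good x")
  case False
  then have "card (star v) = 3" if "v \<in> V" for v
    using that sp unfolding special_iff good_def by blast
  then show ?thesis unfolding cubic_iff by blast
next
  case True
  then obtain x where x: "x \<in> V" "good x" by blast
  show ?thesis
  proof (cases "\<exists>u v. {u, v} \<in> edge_ends \<and> good u \<and> \<not> good v")
    case True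
    then obtain u v where uv: "{u, v} \<in> edge_ends" "good u" "\<not> good v" by blast
    then show ?thesis
      using good_neighbour_not_good_imp_wheel[OF conn sp _ uv(2,1,3)] pair_edge_ends by blast
  next
    case False
    then have good: "V \<subseteq> {v. good v}" using connected_graph_closed[OF conn x(1), of "{v. good v}"] x by blast
    have tri: "card (boundary F) = 3" if F: "F \<in> faces V E" for F
    proof -
      have "boundary F \<noteq> {}" using sp F unfolding special_iff by fastforce
      then obtain s where s: "s \<in> boundary F" by auto
      then have "s \<in> edge_ends" using boundary_subset by blast
      then obtain a b where "a \<in> V" "s = {a, b}" using edge_ends_doubleton by metis
      then show ?thesis using goodD[of a F s] good F s by auto
    qed
    show ?thesis
    proof (cases "card edge_ends > 3")
      case True
      then show ?thesis unfolding sphere_triangulation_iff using tri by blast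
    next
      \<comment> \<open>\<open>sphere_triangulation\<close> demands more than three edges. Otherwise
        all degrees are at most 3, and being special makes them equal to 3, so the graph counts as
        cubic.\<close>
      case False
      have "card (star v) = 3" if "v \<in> V" for v
      proof -
        have "star v \<subseteq> edge_ends" unfolding star_def by auto
        then have "card (star v) \<le> card edge_ends" by (rule card_mono[OF finite_edge_ends])
        then show ?thesis using False sp that unfolding special_iff by fastforce
      qed
      then show ?thesis unfolding cubic_iff by blast
    qed
  qed
qed

end

theorem theorem7:
  fixes V :: "complex set" and E :: "complex set set"
  assumes "plane_graph V E" and "simple_edges V E" and "connected_graph V E"
  shows "special V E \<longleftrightarrow> cubic V E \<or> sphere_triangulation V E \<or> wheel V E"
proof (cases "\<forall>v\<in>V. \<exists>e\<in>E. v \<in> e")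
  case True
  then interpret simple_plane V E
    using assms by unfold_locales auto
  show ?thesis
    using special_imp[OF assms(3)] cubic_imp_special sphere_triangulation_imp_special wheel_imp_special
    by blast
next
  case False
  then obtain v where v: "v \<in> V" "\<And>e. e \<in> E \<Longrightarrow> v \<notin> e" by blast
  have "{e \<in> E. v \<in> e} = {}" using v(2) by blast
  then have deg: "vertex_degree E v = 0" unfolding vertex_degree_def by (simp only: card.empty)
  \<comment> \<open>A connected graph with an isolated vertex is a single point without edges, and
    all four properties fail for it.\<close>
  have "u = v" if "u \<in> V" for u
  proof -
    have "(adjacent V E)\<^sup>*\<^sup>* v u" using assms(3) v(1) that unfolding connected_graph_def by blast
    moreover have "\<not> adjacent V E v w" for w using v unfolding adjacent_def ends_def by blast
    ultimately show ?thesis by (metis converse_rtranclpE)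
  qed
  then have V: "V = {v}" using v(1) by blast
  have "E = {}"
  proof (rule ccontr)
    assume "E \<noteq> {}"
    then obtain e where e: "e \<in> E" by auto
    interpret plane V E by unfold_locales (rule assms(1))
    obtain g where "e \<inter> V = {g (0::real), g 1}" by (rule edge_arc[OF e])
    then have "e \<inter> V \<noteq> {}" by simp
    then show False using V v(2)[OF e] by simp
  qed
  have "\<not> special V E" "\<not> cubic V E" unfolding special_def cubic_def using V deg by auto
  moreover have "\<not> sphere_triangulation V E" unfolding sphere_triangulation_def using \<open>E = {}\<close> by simp
  moreover have "\<not> wheel V E"
  proof
    assume "wheel V E"
    then have "\<exists>n\<ge>3. \<exists>x. \<exists>y :: nat \<Rightarrow> complex. x \<notin> y ` {..<n} \<and> V = insert x (y ` {..<n})"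
      unfolding wheel_def by (elim exE conjE) (intro exI conjI)
    then obtain n x and y :: "nat \<Rightarrow> complex" where "n \<ge> 3" "x \<notin> y ` {..<n}" "V = insert x (y ` {..<n})"
      by (elim exE conjE)
    then have "x \<in> V" "y 0 \<in> V" "x \<noteq> y 0" by auto
    then show False using V by auto
  qed
  ultimately show ?thesis by blast
qed

end
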